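(* Let $[H,G]$ be a Boolean group-complemented interval of finite groups, of rank $n+1$, and let $P = C(H,G)$. Then the nontrivial reduced Betti number of the order complex $\Delta(P)$, namely $\tilde{\beta}_n(\Delta(P))$, is exactly the dual Euler totient $\hat{\varphi}(H,G)$. It is then the number of cosets $Hg$ ($g \in G$) such that $\langle Hg \rangle = G$, which is nonzero.
   Context: An interval of finite groups $[H,G]$ is the lattice of all subgroups $K$ with $H \subseteq K \subseteq G$, where $G$ is a finite group and $H$ a subgroup. It is Boolean of rank $m$ if it is isomorphic to the lattice of subsets of an $m$-element set; then each $K \in [H,G]$ has a unique lattice-complement $K^{\complement}$. A Boolean interval is group-complemented if $KK^{\complement} = G$ (as a product set) for every $K \in [H,G]$. The coset poset $C(H,G)$ is the set of all right cosets $Kg$ with $g \in G$ and $K \in [H,G]$, $K \neq G$, ordered by inclusion. The order complex $\Delta(P)$ of a finite poset $P$ is the simplicial complex whose faces are the chains of $P$; here $\dim\Delta(P)=n$. $\tilde{\beta}_i(\Delta)$ denotes the dimension of the $i$th reduced homology (over $\mathbb{C}$) of $\Delta$. The dual Euler totient is $\hat{\varphi}(H,G) := \sum_{K \in [H,G]} \mu(H,K)\,|G:K|$, with $\mu$ the Möbius function of the lattice $[H,G]$. $\langle Hg\rangle = \langle H,g\rangle$ is the subgroup generated by the coset $Hg$. *)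

theory Defs
  imports Complex_Main "HOL-Algebra.Generated_Groups"
begin

definition subgroup_interval :: "('a, 'b) monoid_scheme \<Rightarrow> 'a set \<Rightarrow> 'a set set"
  where "subgroup_interval G H = {K. subgroup K G \<and> H \<subseteq> K}"

text \<open>An order isomorphism between lattices is the same as a lattice isomorphism.\<close>

definition boolean_interval :: "('a, 'b) monoid_scheme \<Rightarrow> 'a set \<Rightarrow> nat \<Rightarrow> bool"
  where "boolean_interval G H m \<longleftrightarrow>
    (\<exists>f. bij_betw f (subgroup_interval G H) (Pow {..<m}) \<and>
         (\<forall>K\<in>subgroup_interval G H. \<forall>L\<in>subgroup_interval G H. K \<subseteq> L \<longleftrightarrow> f K \<subseteq> f L))"

text \<open>In the interval, the meet is intersection and the join is the generated subgroup.  The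
  complement is unique, hence this description is meaningful, when the interval is Boolean.\<close>

definition lattice_complement :: "('a, 'b) monoid_scheme \<Rightarrow> 'a set \<Rightarrow> 'a set \<Rightarrow> 'a set"
  where "lattice_complement G H K =
    (THE L. L \<in> subgroup_interval G H \<and> K \<inter> L = H \<and> generate G (K \<union> L) = carrier G)"

definition group_complemented :: "('a, 'b) monoid_scheme \<Rightarrow> 'a set \<Rightarrow> bool"
  where "group_complemented G H \<longleftrightarrow>
    (\<forall>K\<in>subgroup_interval G H. K <#>\<^bsub>G\<^esub> lattice_complement G H K = carrier G)"

definition coset_poset :: "('a, 'b) monoid_scheme \<Rightarrow> 'a set \<Rightarrow> 'a set set"
  where "coset_poset G H =
    {K #>\<^bsub>G\<^esub> g | K g. K \<in> subgroup_interval G H \<and> K \<noteq> carrier G \<and> g \<in> carrier G}"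

text \<open>The Moebius function of a finite poset \<open>P\<close>, with the order inherited from the ambient type
  (for sets: inclusion); it is \<open>0\<close> outside its proper domain.\<close>

function mobius :: "'b::order set \<Rightarrow> 'b \<Rightarrow> 'b \<Rightarrow> int"
  where "mobius P x y =
    (if finite P \<and> x \<in> P \<and> y \<in> P \<and> x \<le> y
     then if x = y then 1 else - (\<Sum>z\<in>{z\<in>P. x \<le> z \<and> z < y}. mobius P x z)
     else 0)"
  by auto
termination
proof (relation "measure (\<lambda>(P, x, y). card {z\<in>P. z \<le> y})", goal_cases)
  case 1
  then show ?case by simp
next
  case (2 P x y z)
  then have "{w\<in>P. w \<le> z} \<subset> {w\<in>P. w \<le> y}" by force
  with 2 show ?case by (simp add: psubset_card_mono)
qed

declare mobius.simps [simp del]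

definition dual_totient :: "('a, 'b) monoid_scheme \<Rightarrow> 'a set \<Rightarrow> int"
  where "dual_totient G H =
    (\<Sum>K\<in>subgroup_interval G H.
       mobius (subgroup_interval G H) H K * int (card (rcosets\<^bsub>G\<^esub> K)))"

text \<open>The empty face is included; it spans the chains of degree \<open>-1\<close>.\<close>

definition order_complex :: "'b::order set \<Rightarrow> 'b set set"
  where "order_complex P = {\<sigma>. finite \<sigma> \<and> \<sigma> \<subseteq> P \<and> Complete_Partial_Order.chain (\<le>) \<sigma>}"

text \<open>In the following, \<open>\<Delta>\<close> is a finite simplicial complex (containing the empty face) each of
  whose faces is totally ordered by \<open>\<le>\<close>, and is oriented by this order.  A simplicial chain
  is represented by its coefficient function.\<close>

definition simplicial_chains :: "'b set set \<Rightarrow> int \<Rightarrow> ('b set \<Rightarrow> complex) set"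
  where "simplicial_chains \<Delta> p = {c. \<forall>\<sigma>. c \<sigma> \<noteq> 0 \<longrightarrow> \<sigma> \<in> \<Delta> \<and> int (card \<sigma>) = p + 1}"

text \<open>The linear extension of
  \<open>\<partial>{x\<^sub>0 < \<dots> < x\<^sub>p} = (\<Sum>i\<le>p. (-1)^i {x\<^sub>0, \<dots>, x\<^sub>p} - {x\<^sub>i})\<close>:
  the faces having \<open>\<tau>\<close> in their boundary arise by adding a vertex \<open>v\<close>, whose position is the
  number of smaller vertices in \<open>\<tau>\<close>.\<close>

definition boundary :: "'b::order set set \<Rightarrow> ('b set \<Rightarrow> complex) \<Rightarrow> 'b set \<Rightarrow> complex"
  where "boundary \<Delta> c \<tau> =
    (\<Sum>v | v \<notin> \<tau> \<and> insert v \<tau> \<in> \<Delta>. (-1) ^ card {u\<in>\<tau>. u < v} * c (insert v \<tau>))"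

definition cycles :: "'b::order set set \<Rightarrow> int \<Rightarrow> ('b set \<Rightarrow> complex) set"
  where "cycles \<Delta> p = {c \<in> simplicial_chains \<Delta> p. boundary \<Delta> c = (\<lambda>_. 0)}"

definition boundaries :: "'b::order set set \<Rightarrow> int \<Rightarrow> ('b set \<Rightarrow> complex) set"
  where "boundaries \<Delta> p = boundary \<Delta> ` simplicial_chains \<Delta> (p + 1)"

text \<open>For subspaces \<open>W \<subseteq> V\<close> of a complex function space, \<open>quotient_basis V W S\<close> says that the
  classes of the elements of \<open>S\<close> are distinct and form a finite basis of \<open>V / W\<close>: every class has
  unique coordinates \<open>a\<close> with respect to them.\<close>

definition quotient_basis :: "('c \<Rightarrow> complex) set \<Rightarrow> ('c \<Rightarrow> complex) set \<Rightarrow> ('c \<Rightarrow> complex) set \<Rightarrow> bool"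
  where "quotient_basis V W S \<longleftrightarrow> finite S \<and> S \<subseteq> V \<and>
    (\<forall>v\<in>V. \<exists>!a. (\<forall>s. s \<notin> S \<longrightarrow> a s = 0) \<and> (\<lambda>x. v x - (\<Sum>s\<in>S. a s * s x)) \<in> W)"

definition quotient_dim :: "('c \<Rightarrow> complex) set \<Rightarrow> ('c \<Rightarrow> complex) set \<Rightarrow> nat"
  where "quotient_dim V W = (THE k. \<exists>S. quotient_basis V W S \<and> card S = k)"

definition reduced_betti :: "'b::order set set \<Rightarrow> int \<Rightarrow> nat"
  where "reduced_betti \<Delta> p = quotient_dim (cycles \<Delta> p) (boundaries \<Delta> p)"

end

theory Submission imports Defs begin

text \<open>Let \<open>M\<^sub>i\<close> be the coatoms of the interval. Group-complementedness yields \<open>M\<^sub>i K = G\<close> whenever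
  \<open>K\<close> is an intersection of coatoms other than \<open>M\<^sub>i\<close>, whence a Chinese remainder theorem: cosets
  of distinct coatoms always meet, and the right cosets of \<open>\<Inter>\<^sub>i\<^sub>\<in>\<^sub>S M\<^sub>i\<close> correspond to the choices
  of one coset of each \<open>M\<^sub>i\<close>, \<open>i \<in> S\<close>. So the coset poset is dual to the face poset of the join
  of the discrete sets \<open>M\<^sub>i \ G\<close>, and both the dual Euler totient and the number of generating cosets
  equal \<open>\<Prod>\<^sub>i (|G : M\<^sub>i| - 1)\<close>, which is positive. The order complex of this face poset is built from the
  void complex by inverse elementary collapses and the attachment of as many cells of the top
  dimension; each such cell raises the top Betti number by one because the homology one degree
  below vanishes.\<close>

subsection \<open>Bases of quotients of function spaces\<close>

text \<open>The obstacle is that a Betti number is here a definite description over bases of cycles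
  modulo boundaries, so every value must come with an explicit basis; hence the incremental
  construction, which adds one basis vector at a time. Its induction has to control all degrees at
  once: attaching an \<open>n\<close>-cell needs a filling of its boundary in degree
  \<open>n - 1\<close>, and since pairs change nothing and all cells have dimension
  \<open>n\<close>, every degree other than \<open>n\<close> stays zero. Starting from the void
  complex keeps this true in degree \<open>-1\<close> and makes rank 0 an ordinary case: there the
  complex is the empty face alone, a single cell of dimension \<open>-1\<close>. The construction is
  stated for sets of vertices without any order, since the passage from transversals to cosets
  reverses inclusion and may change the signs of the boundary map; homology is computed only after
  this passage. Group-complementedness enters through the complement of a coatom, which is the meet
  of all the other coatoms; fewer coatoms have a larger meet, so the product with it is
  \<open>G\<close> as well.\<close>

definition lin_closed :: "('c \<Rightarrow> complex) set \<Rightarrow> bool"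
  where "lin_closed W \<longleftrightarrow> (\<lambda>_. 0) \<in> W \<and> (\<forall>u\<in>W. \<forall>v\<in>W. \<forall>b. (\<lambda>x. u x + b * v x) \<in> W)"

lemma lin_closed_zero: "lin_closed W \<Longrightarrow> (\<lambda>_. 0) \<in> W"
  by (simp add: lin_closed_def)

lemma lin_closed_add_scaled:
  "lin_closed W \<Longrightarrow> u \<in> W \<Longrightarrow> v \<in> W \<Longrightarrow> (\<lambda>x. u x + b * v x) \<in> W"
  by (simp add: lin_closed_def)

lemma lin_closed_diff: "lin_closed W \<Longrightarrow> u \<in> W \<Longrightarrow> v \<in> W \<Longrightarrow> (\<lambda>x. u x - v x) \<in> W"
  using lin_closed_add_scaled[of W u v "-1"] by simp

lemma lin_closed_sum:
  assumes "lin_closed W" and "finite T" and "\<And>t. t \<in> T \<Longrightarrow> u t \<in> W"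
  shows "(\<lambda>x. \<Sum>t\<in>T. b t * u t x) \<in> W"
  using assms(2,3)
proof (induction T rule: finite_induct)
  case empty
  then show ?case using lin_closed_zero[OF assms(1)] by simp
next
  case (insert t T)
  then have "(\<lambda>x. (\<Sum>t\<in>T. b t * u t x) + b t * u t x) \<in> W"
    by (intro lin_closed_add_scaled[OF assms(1)]) auto
  with insert show ?case by (simp add: add.commute)
qed

lemma quotient_basis_coordinates:
  assumes "quotient_basis V W S" and "v \<in> V"
  obtains a where "(\<lambda>x. v x - (\<Sum>s\<in>S. a s * s x)) \<in> W"
proof -
  have "\<exists>!a. (\<forall>s. s \<notin> S \<longrightarrow> a s = 0) \<and> (\<lambda>x. v x - (\<Sum>s\<in>S. a s * s x)) \<in> W"
    using assms by (simp add: quotient_basis_def)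
  then show thesis by (elim ex1E conjE) (rule that)
qed

lemma quotient_basis_coordinates_unique:
  assumes "quotient_basis V W S" and "v \<in> V"
    and "\<And>s. s \<notin> S \<Longrightarrow> a s = 0" and "(\<lambda>x. v x - (\<Sum>s\<in>S. a s * s x)) \<in> W"
    and "\<And>s. s \<notin> S \<Longrightarrow> b s = 0" and "(\<lambda>x. v x - (\<Sum>s\<in>S. b s * s x)) \<in> W"
  shows "a = b"
proof -
  let ?P = "\<lambda>a. (\<forall>s. s \<notin> S \<longrightarrow> a s = 0) \<and> (\<lambda>x. v x - (\<Sum>s\<in>S. a s * s x)) \<in> W"
  have "\<exists>!a. ?P a"
    using assms(1,2) by (simp add: quotient_basis_def)
  then obtain c where c: "\<forall>a. ?P a \<longrightarrow> a = c" by (elim ex1E)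
  have "a = c" by (rule c[rule_format]) (use assms in auto)
  moreover have "b = c" by (rule c[rule_format]) (use assms in auto)
  ultimately show ?thesis by simp
qed

text \<open>Expanding \<open>s\<close> in \<open>T\<close> and the result in \<open>S\<close> yields
  a second coordinate vector of \<open>s\<close>; uniqueness of coordinates makes it the unit
  vector. This is a diagonal entry of the product of the transition matrices, all that a trace
  argument needs.\<close>

lemma quotient_basis_change:
  assumes W: "lin_closed W" and S: "quotient_basis V W S" and T: "finite T"
    and a: "\<And>s. s \<in> S \<Longrightarrow> (\<lambda>x. s x - (\<Sum>t\<in>T. a s t * t x)) \<in> W"
    and b: "\<And>t. t \<in> T \<Longrightarrow> (\<lambda>x. t x - (\<Sum>s\<in>S. b t s * s x)) \<in> W"
    and s: "s \<in> S"
  shows "(\<Sum>t\<in>T. a s t * b t s) = 1"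
proof -
  have fin: "finite S" and SV: "S \<subseteq> V"
    using S by (auto simp: quotient_basis_def)
  \<comment> \<open>Cut off outside \<open>S\<close>, because coordinate functions are unique only
    among those vanishing there.\<close>
  let ?c = "\<lambda>r. if r \<in> S then \<Sum>t\<in>T. a s t * b t r else 0"
  let ?d = "\<lambda>r. if r = s then 1 else (0::complex)"
  have "(\<lambda>x. (s x - (\<Sum>t\<in>T. a s t * t x))
      + 1 * (\<Sum>t\<in>T. a s t * (t x - (\<Sum>r\<in>S. b t r * r x)))) \<in> W"
    by (intro lin_closed_add_scaled[OF W] a s lin_closed_sum[OF W T] b)
  moreover have "(s x - (\<Sum>t\<in>T. a s t * t x))
      + 1 * (\<Sum>t\<in>T. a s t * (t x - (\<Sum>r\<in>S. b t r * r x))) = s x - (\<Sum>r\<in>S. ?c r * r x)" for x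
  proof -
    have "(\<Sum>r\<in>S. ?c r * r x) = (\<Sum>r\<in>S. \<Sum>t\<in>T. a s t * (b t r * r x))"
      by (rule sum.cong) (auto simp: sum_distrib_right mult.assoc)
    also have "\<dots> = (\<Sum>t\<in>T. a s t * (\<Sum>r\<in>S. b t r * r x))"
      by (subst sum.swap) (simp add: sum_distrib_left)
    finally show ?thesis by (simp add: right_diff_distrib sum_subtractf)
  qed
  ultimately have 1: "(\<lambda>x. s x - (\<Sum>r\<in>S. ?c r * r x)) \<in> W" by (simp only:)
  have "(\<Sum>r\<in>S. ?d r * r x) = s x" for x
    using fin s by (simp add: if_distrib[of "\<lambda>z. z * _"] cong: if_cong)
  then have 2: "(\<lambda>x. s x - (\<Sum>r\<in>S. ?d r * r x)) \<in> W"
    using lin_closed_zero[OF W] by (simp only: diff_self)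
  have "?c = ?d"
    by (rule quotient_basis_coordinates_unique[OF S subsetD[OF SV s] _ 1 _ 2]) (use s in auto)
  then have "?c s = ?d s" by (rule fun_cong)
  then show ?thesis using s by simp
qed

text \<open>The two transition matrices are inverse to each other, so that the trace of their products
  in the two orders gives the cardinality of either basis.\<close>

lemma quotient_basis_card_unique:
  assumes W: "lin_closed W" and S: "quotient_basis V W S" and T: "quotient_basis V W T"
  shows "card S = card T"
proof -
  have fin: "finite S" "finite T" and sub: "S \<subseteq> V" "T \<subseteq> V"
    using S T by (auto simp: quotient_basis_def)
  have "\<forall>s\<in>S. \<exists>e. (\<lambda>x. s x - (\<Sum>t\<in>T. e t * t x)) \<in> W"
    using quotient_basis_coordinates[OF T] sub by (meson subsetD)
  from bchoice[OF this] obtain a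
    where a: "\<And>s. s \<in> S \<Longrightarrow> (\<lambda>x. s x - (\<Sum>t\<in>T. a s t * t x)) \<in> W"
    by blast
  have "\<forall>t\<in>T. \<exists>e. (\<lambda>x. t x - (\<Sum>s\<in>S. e s * s x)) \<in> W"
    using quotient_basis_coordinates[OF S] sub by (meson subsetD)
  from bchoice[OF this] obtain b
    where b: "\<And>t. t \<in> T \<Longrightarrow> (\<lambda>x. t x - (\<Sum>s\<in>S. b t s * s x)) \<in> W"
    by blast
  have "of_nat (card S) = (\<Sum>s\<in>S. \<Sum>t\<in>T. a s t * b t s)"
    using quotient_basis_change[OF W S fin(2) a b] by (simp cong: sum.cong)
  also have "\<dots> = (\<Sum>t\<in>T. \<Sum>s\<in>S. b t s * a s t)"
    by (subst sum.swap) (simp add: mult.commute)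
  also have "\<dots> = (of_nat (card T) :: complex)"
    using quotient_basis_change[OF W T fin(1) b a] by simp
  finally show ?thesis by simp
qed

lemma quotient_dim_eq:
  assumes "lin_closed W" and "quotient_basis V W S"
  shows "quotient_dim V W = card S"
  unfolding quotient_dim_def using assms quotient_basis_card_unique by blast

lemma quotient_basis_empty_iff: "quotient_basis V W {} \<longleftrightarrow> V \<subseteq> W"
proof -
  have "(\<exists>!a. (\<forall>s. a s = (0::complex)) \<and> v \<in> W) \<longleftrightarrow> v \<in> W" for v :: "'a \<Rightarrow> complex"
    by (auto intro!: ex1I[of _ "\<lambda>_. 0"])
  then show ?thesis by (auto simp: quotient_basis_def)
qed

text \<open>The hypotheses say that the inclusion induces an isomorphism of \<open>V / W\<close> with \<open>V' / W'\<close>.\<close>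

lemma quotient_basis_transfer:
  assumes V: "lin_closed V" and W': "lin_closed W'" and "V \<subseteq> V'" and "W \<subseteq> W'"
    and surj: "\<And>v. v \<in> V' \<Longrightarrow> \<exists>u\<in>V. (\<lambda>x. v x - u x) \<in> W'"
    and inj: "V \<inter> W' \<subseteq> W"
    and S: "quotient_basis V W S"
  shows "quotient_basis V' W' S"
  unfolding quotient_basis_def
proof (intro conjI ballI)
  show fin: "finite S" using S by (simp add: quotient_basis_def)
  have SV: "S \<subseteq> V" using S by (simp add: quotient_basis_def)
  then show "S \<subseteq> V'" using \<open>V \<subseteq> V'\<close> by simp
  fix v assume "v \<in> V'"
  then obtain u where u: "u \<in> V" "(\<lambda>x. v x - u x) \<in> W'" using surj by blast
  \<comment> \<open>\<open>v\<close> modulo \<open>W'\<close> and its representative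
    \<open>u\<close> modulo \<open>W\<close> admit the same coordinate functions, so the unique
    existence carries over verbatim.\<close>
  have "(\<lambda>x. v x - (\<Sum>s\<in>S. a s * s x)) \<in> W' \<longleftrightarrow> (\<lambda>x. u x - (\<Sum>s\<in>S. a s * s x)) \<in> W" for a
  proof
    assume "(\<lambda>x. v x - (\<Sum>s\<in>S. a s * s x)) \<in> W'"
    from lin_closed_diff[OF W' this u(2)] have "(\<lambda>x. u x - (\<Sum>s\<in>S. a s * s x)) \<in> W'" by simp
    moreover have "(\<lambda>x. u x - (\<Sum>s\<in>S. a s * s x)) \<in> V"
      using SV by (intro lin_closed_diff[OF V] u lin_closed_sum[OF V fin]) auto
    ultimately show "(\<lambda>x. u x - (\<Sum>s\<in>S. a s * s x)) \<in> W" using inj by blast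
  next
    assume "(\<lambda>x. u x - (\<Sum>s\<in>S. a s * s x)) \<in> W"
    then have "(\<lambda>x. u x - (\<Sum>s\<in>S. a s * s x)) \<in> W'" using \<open>W \<subseteq> W'\<close> by blast
    from lin_closed_add_scaled[OF W' u(2) this, of 1]
    show "(\<lambda>x. v x - (\<Sum>s\<in>S. a s * s x)) \<in> W'" by simp
  qed
  then show "\<exists>!a. (\<forall>s. s \<notin> S \<longrightarrow> a s = 0) \<and> (\<lambda>x. v x - (\<Sum>s\<in>S. a s * s x)) \<in> W'"
    using S u(1) by (simp add: quotient_basis_def)
qed

text \<open>Evaluation at \<open>y\<close> is a linear functional that vanishes on \<open>V\<close>
  and is 1 at \<open>z\<close>; hence \<open>V'\<close> is the direct sum of \<open>V\<close> and
  the line through \<open>z\<close>. As \<open>W\<close> lies in \<open>V\<close>, the quotient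
  gains exactly one dimension.\<close>

lemma quotient_basis_insert:
  assumes S: "quotient_basis V W S" and "V \<subseteq> V'" and "W \<subseteq> V" and z: "z \<in> V'" "z y = 1"
    and vanish: "\<And>v. v \<in> V \<Longrightarrow> v y = 0"
    and V': "\<And>v. v \<in> V' \<Longrightarrow> (\<lambda>x. v x - v y * z x) \<in> V"
  shows "quotient_basis V' W (insert z S)"
  unfolding quotient_basis_def
proof (intro conjI ballI)
  have fin: "finite S" and SV: "S \<subseteq> V" using S by (auto simp: quotient_basis_def)
  show "finite (insert z S)" using fin by simp
  show "insert z S \<subseteq> V'" using SV \<open>V \<subseteq> V'\<close> z by auto
  have zS: "z \<notin> S" using SV vanish z by fastforce
  have Sy: "(\<Sum>s\<in>S. a s * s y) = 0" for a
    using SV vanish by (intro sum.neutral) auto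
  fix v assume "v \<in> V'"
  let ?u = "\<lambda>x. v x - v y * z x"
  let ?P = "\<lambda>a. (\<forall>s. s \<notin> insert z S \<longrightarrow> a s = 0) \<and> (\<lambda>x. v x - (\<Sum>s\<in>insert z S. a s * s x)) \<in> W"
  let ?R = "\<lambda>a. (\<forall>s. s \<notin> S \<longrightarrow> a s = 0) \<and> (\<lambda>x. ?u x - (\<Sum>s\<in>S. a s * s x)) \<in> W"
  have ex: "\<exists>!a. ?R a"
    using S V'[OF \<open>v \<in> V'\<close>] by (simp add: quotient_basis_def)
  have upd: "(\<Sum>s\<in>S. (a(z := r)) s * s x) = (\<Sum>s\<in>S. a s * s x)" for a r x
    using zS by (intro sum.cong) auto
  \<comment> \<open>Evaluating the remainder at \<open>y\<close> forces the coordinate of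
    \<open>z\<close>; what is left are coordinates of \<open>?u\<close> with respect to
    \<open>S\<close>.\<close>
  have PR: "?R (a(z := 0)) \<and> a z = v y" if "?P a" for a
  proof -
    have "(\<lambda>x. v x - (\<Sum>s\<in>insert z S. a s * s x)) \<in> V" using that \<open>W \<subseteq> V\<close> by blast
    from vanish[OF this] have az: "a z = v y" using fin zS z Sy[of a] by simp
    moreover have "(\<lambda>x. ?u x - (\<Sum>s\<in>S. (a(z := 0)) s * s x)) \<in> W"
      unfolding upd using that fin zS az by (simp add: diff_diff_eq)
    ultimately show ?thesis using that by auto
  qed
  from ex obtain a where a: "?R a" by blast
  have "?P (a(z := v y))"
  proof
    show "\<forall>s. s \<notin> insert z S \<longrightarrow> (a(z := v y)) s = 0" using a by auto
    have "(\<Sum>s\<in>insert z S. (a(z := v y)) s * s x) = v y * z x + (\<Sum>s\<in>S. a s * s x)" for x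
      using fin zS upd[of a "v y" x] by simp
    then show "(\<lambda>x. v x - (\<Sum>s\<in>insert z S. (a(z := v y)) s * s x)) \<in> W"
      using a by (simp add: diff_diff_eq)
  qed
  moreover have "b = a(z := v y)" if "?P b" for b
  proof -
    have "b(z := 0) = a" using ex a PR[OF that] by blast
    then show ?thesis using PR[OF that] by (metis fun_upd_triv fun_upd_upd)
  qed
  ultimately show "\<exists>!a. ?P a" by blast
qed

subsection \<open>Homology of ordered simplicial complexes\<close>

definition ordered_complex :: "'b::order set set \<Rightarrow> bool"
  where "ordered_complex \<Delta> \<longleftrightarrow> finite \<Delta> \<and>
    (\<forall>\<sigma>\<in>\<Delta>. finite \<sigma> \<and> Complete_Partial_Order.chain (\<le>) \<sigma> \<and> (\<forall>\<rho>\<subseteq>\<sigma>. \<rho> \<in> \<Delta>))"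

lemma ordered_complexD:
  assumes "ordered_complex \<Delta>" and "\<sigma> \<in> \<Delta>"
  shows "finite \<sigma>" and "Complete_Partial_Order.chain (\<le>) \<sigma>" and "\<rho> \<subseteq> \<sigma> \<Longrightarrow> \<rho> \<in> \<Delta>"
  using assms by (auto simp: ordered_complex_def)

lemma finite_cofaces:
  assumes "ordered_complex \<Delta>"
  shows "finite {v. v \<notin> \<tau> \<and> insert v \<tau> \<in> \<Delta>}"
proof (rule finite_subset)
  show "{v. v \<notin> \<tau> \<and> insert v \<tau> \<in> \<Delta>} \<subseteq> \<Union>\<Delta>" by auto
  show "finite (\<Union>\<Delta>)" using assms by (auto simp: ordered_complex_def)
qed

lemma lin_closed_simplicial_chains: "lin_closed (simplicial_chains \<Delta> p)"
  unfolding lin_closed_def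
proof (intro conjI ballI allI)
  fix c d b assume cd: "c \<in> simplicial_chains \<Delta> p" "d \<in> simplicial_chains \<Delta> p"
  have "c \<sigma> \<noteq> 0 \<or> d \<sigma> \<noteq> 0" if "c \<sigma> + b * d \<sigma> \<noteq> 0" for \<sigma>
    using that by auto
  with cd show "(\<lambda>\<sigma>. c \<sigma> + b * d \<sigma>) \<in> simplicial_chains \<Delta> p"
    unfolding simplicial_chains_def by blast
qed (simp add: simplicial_chains_def)

lemma boundary_add_scaled:
  "boundary \<Delta> (\<lambda>\<sigma>. c \<sigma> + b * d \<sigma>) = (\<lambda>\<tau>. boundary \<Delta> c \<tau> + b * boundary \<Delta> d \<tau>)"
  by (simp add: boundary_def fun_eq_iff sum.distrib sum_distrib_left algebra_simps)

lemma boundary_zero: "boundary \<Delta> (\<lambda>_. 0) = (\<lambda>_. 0)"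
  by (simp add: boundary_def fun_eq_iff)

lemma boundary_diff:
  "boundary \<Delta> (\<lambda>\<sigma>. c \<sigma> - d \<sigma>) = (\<lambda>\<tau>. boundary \<Delta> c \<tau> - boundary \<Delta> d \<tau>)"
  using boundary_add_scaled[of \<Delta> c "-1" d] by simp

lemma lin_closed_cycles: "lin_closed (cycles \<Delta> p)"
  using lin_closed_simplicial_chains[of \<Delta> p]
  by (auto simp: lin_closed_def cycles_def boundary_add_scaled boundary_zero)

lemma lin_closed_boundaries: "lin_closed (boundaries \<Delta> p)"
  unfolding lin_closed_def boundaries_def
proof (intro conjI ballI allI)
  show "(\<lambda>_. 0) \<in> boundary \<Delta> ` simplicial_chains \<Delta> (p + 1)"
    using lin_closed_zero[OF lin_closed_simplicial_chains]
    by (rule rev_image_eqI) (simp add: boundary_zero)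
  fix u v b
  assume "u \<in> boundary \<Delta> ` simplicial_chains \<Delta> (p + 1)"
    "v \<in> boundary \<Delta> ` simplicial_chains \<Delta> (p + 1)"
  then show "(\<lambda>x. u x + b * v x) \<in> boundary \<Delta> ` simplicial_chains \<Delta> (p + 1)"
    using lin_closed_add_scaled[OF lin_closed_simplicial_chains]
    by (auto simp flip: boundary_add_scaled intro!: imageI)
qed

lemma simplicial_chains_mono: "\<Delta> \<subseteq> \<Delta>' \<Longrightarrow> simplicial_chains \<Delta> p \<subseteq> simplicial_chains \<Delta>' p"
  by (auto simp: simplicial_chains_def)

lemma boundary_in_chains:
  assumes "ordered_complex \<Delta>" and "c \<in> simplicial_chains \<Delta> (p + 1)"
  shows "boundary \<Delta> c \<in> simplicial_chains \<Delta> p"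
  unfolding simplicial_chains_def
proof (intro CollectI allI impI)
  fix \<tau> assume "boundary \<Delta> c \<tau> \<noteq> 0"
  then obtain v where v: "v \<notin> \<tau>" "insert v \<tau> \<in> \<Delta>" "c (insert v \<tau>) \<noteq> 0"
    unfolding boundary_def by (auto elim!: sum.not_neutral_contains_not_neutral)
  then have "int (card (insert v \<tau>)) = p + 2" and "finite \<tau>"
    using assms ordered_complexD(1)[OF assms(1) v(2)] by (auto simp: simplicial_chains_def)
  then show "\<tau> \<in> \<Delta> \<and> int (card \<tau>) = p + 1"
    using v ordered_complexD(3)[OF assms(1) v(2)] by auto
qed

text \<open>The additional cofaces in \<open>\<Delta>'\<close> carry coefficient 0, so a chain of a
  subcomplex has one boundary, wherever it is computed.\<close>

lemma boundary_restrict: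
  assumes "ordered_complex \<Delta>'" and "\<Delta> \<subseteq> \<Delta>'" and "c \<in> simplicial_chains \<Delta> p"
  shows "boundary \<Delta>' c = boundary \<Delta> c"
proof
  fix \<tau>
  show "boundary \<Delta>' c \<tau> = boundary \<Delta> c \<tau>"
    unfolding boundary_def using assms finite_cofaces[OF assms(1), of \<tau>]
    by (intro sum.mono_neutral_right) (auto simp: simplicial_chains_def)
qed

lemma boundary_boundary:
  assumes \<Delta>: "ordered_complex \<Delta>"
  shows "boundary \<Delta> (boundary \<Delta> c) = (\<lambda>_. 0)"
proof
  fix \<tau>
  define A where "A = {v. v \<notin> \<tau> \<and> insert v \<tau> \<in> \<Delta>}"
  \<comment> \<open>Extended by 0 to all of \<open>A\<close> in both arguments, so that the double
    sum can be swapped and compared with itself.\<close>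
  define g where "g v w = (-1) ^ card {u\<in>\<tau>. u < v} * ((-1) ^ card {u\<in>insert v \<tau>. u < w}
    * (if v \<noteq> w \<and> insert w (insert v \<tau>) \<in> \<Delta> then c (insert w (insert v \<tau>)) else 0))" for v w
  have fin: "finite A" unfolding A_def by (rule finite_cofaces[OF \<Delta>])
  have "boundary \<Delta> (boundary \<Delta> c) \<tau> = (\<Sum>v\<in>A. \<Sum>w\<in>A. g v w)"
    unfolding boundary_def[of \<Delta> "boundary \<Delta> c"] A_def[symmetric]
  proof (rule sum.cong[OF refl])
    fix v assume "v \<in> A"
    have "{w. w \<notin> insert v \<tau> \<and> insert w (insert v \<tau>) \<in> \<Delta>} \<subseteq> A"
    proof
      fix w assume w: "w \<in> {w. w \<notin> insert v \<tau> \<and> insert w (insert v \<tau>) \<in> \<Delta>}"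
      then have "insert w \<tau> \<in> \<Delta>"
        using ordered_complexD(3)[OF \<Delta>, of "insert w (insert v \<tau>)" "insert w \<tau>"] by auto
      with w show "w \<in> A" by (simp add: A_def)
    qed
    then have "boundary \<Delta> c (insert v \<tau>) = (\<Sum>w\<in>A. (-1) ^ card {u\<in>insert v \<tau>. u < w}
      * (if v \<noteq> w \<and> insert w (insert v \<tau>) \<in> \<Delta> then c (insert w (insert v \<tau>)) else 0))"
      unfolding boundary_def by (intro sum.mono_neutral_cong_left fin) (auto simp: A_def)
    then show "(-1) ^ card {u\<in>\<tau>. u < v} * boundary \<Delta> c (insert v \<tau>) = (\<Sum>w\<in>A. g v w)"
      unfolding g_def by (simp add: sum_distrib_left)
  qed
  moreover have anti: "g v w = - g w v" if "v \<in> A" "w \<in> A" for v w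
  proof (cases "v \<noteq> w \<and> insert w (insert v \<tau>) \<in> \<Delta>")
    case True
    have ch: "Complete_Partial_Order.chain (\<le>) (insert w (insert v \<tau>))"
      using True ordered_complexD(2)[OF \<Delta>] by blast
    have ft: "finite \<tau>" using True ordered_complexD(1)[OF \<Delta>, of "insert w (insert v \<tau>)"] by simp
    have c: "card {u \<in> insert a \<tau>. u < b} = (if a < b then Suc (card {u\<in>\<tau>. u < b}) else card {u\<in>\<tau>. u < b})"
      if "a \<in> A" for a b
    proof (cases "a < b")
      case True
      then have "{u \<in> insert a \<tau>. u < b} = insert a {u\<in>\<tau>. u < b}" by auto
      with True \<open>a \<in> A\<close> ft show ?thesis by (simp add: A_def)
    next
      case False
      then have "{u \<in> insert a \<tau>. u < b} = {u\<in>\<tau>. u < b}" by auto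
      with False show ?thesis by simp
    qed
    \<comment> \<open>In a chain exactly one of the two comparisons holds, so exactly one of the two
      vertex counts grows by one when the other vertex is added first: the signs of the two orders
      of insertion are opposite.\<close>
    have "v < w \<and> \<not> w < v \<or> w < v \<and> \<not> v < w"
      using ch True by (auto simp: chain_def less_le)
    then show ?thesis unfolding g_def c[OF that(1)] c[OF that(2)]
      using True by (auto simp: insert_commute)
  next
    case False
    then show ?thesis by (auto simp: g_def insert_commute)
  qed
  moreover have "(\<Sum>v\<in>A. \<Sum>w\<in>A. g v w) = (\<Sum>v\<in>A. \<Sum>w\<in>A. - g w v)"
    by (intro sum.cong refl anti)
  ultimately have "boundary \<Delta> (boundary \<Delta> c) \<tau> = - (\<Sum>v\<in>A. \<Sum>w\<in>A. g w v)"
    by (simp only: sum_negf)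
  also have "(\<Sum>v\<in>A. \<Sum>w\<in>A. g w v) = (\<Sum>v\<in>A. \<Sum>w\<in>A. g v w)"
    by (rule sum.swap)
  finally show "boundary \<Delta> (boundary \<Delta> c) \<tau> = 0"
    using \<open>boundary \<Delta> (boundary \<Delta> c) \<tau> = (\<Sum>v\<in>A. \<Sum>w\<in>A. g v w)\<close> by simp
qed

lemma boundaries_subset_cycles:
  assumes "ordered_complex \<Delta>"
  shows "boundaries \<Delta> p \<subseteq> cycles \<Delta> p"
  using boundary_boundary[OF assms] boundary_in_chains[OF assms]
  by (auto simp: boundaries_def cycles_def)

section \<open>Betti numbers under inverse collapses and cell attachment\<close>

definition elementary_chain :: "'b set \<Rightarrow> 'b set \<Rightarrow> complex"
  where "elementary_chain \<tau> = (\<lambda>\<rho>. if \<rho> = \<tau> then 1 else 0)"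

lemma elementary_chain_in_chains:
  "\<tau> \<in> \<Delta> \<Longrightarrow> int (card \<tau>) = p + 1 \<Longrightarrow> elementary_chain \<tau> \<in> simplicial_chains \<Delta> p"
  by (auto simp: elementary_chain_def simplicial_chains_def)

text \<open>A relational Betti number that asserts the existence of a basis; only after one is
  exhibited can the definite description in \<open>quotient_dim\<close> be evaluated.\<close>

definition betti_basis :: "'b::order set set \<Rightarrow> int \<Rightarrow> nat \<Rightarrow> bool"
  where "betti_basis \<Delta> p k \<longleftrightarrow> (\<exists>S. quotient_basis (cycles \<Delta> p) (boundaries \<Delta> p) S \<and> card S = k)"

lemma reduced_betti_eq: "betti_basis \<Delta> p k \<Longrightarrow> reduced_betti \<Delta> p = k"
  using quotient_dim_eq[OF lin_closed_boundaries] unfolding betti_basis_def reduced_betti_def by blast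

lemma betti_basis_0_iff: "betti_basis \<Delta> p 0 \<longleftrightarrow> cycles \<Delta> p \<subseteq> boundaries \<Delta> p"
proof -
  have "S = {}" if "quotient_basis V W S" "card S = 0" for V W :: "('a set \<Rightarrow> complex) set" and S
    using that by (auto simp: quotient_basis_def)
  then show ?thesis unfolding betti_basis_def by (metis card.empty quotient_basis_empty_iff)
qed

text \<open>The relative chains live in two adjacent degrees, spanned by
  \<open>insert v \<sigma>\<close> and \<open>\<sigma>\<close>, and the boundary between them is
  multiplication by the sign \<open>\<epsilon>\<close>, an isomorphism. So the inclusion induces an
  isomorphism on homology.\<close>

lemma betti_basis_free_pair:
  assumes \<Delta>': "ordered_complex (insert (insert v \<sigma>) (insert \<sigma> \<Delta>))" (is "ordered_complex ?\<Delta>'")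
    and \<Delta>: "ordered_complex \<Delta>" and v: "v \<notin> \<sigma>" and new: "\<sigma> \<notin> \<Delta>"
    and k: "betti_basis \<Delta> p k"
  shows "betti_basis (insert (insert v \<sigma>) (insert \<sigma> \<Delta>)) p k"
proof -
  let ?\<tau> = "insert v \<sigma>"
  define \<epsilon> :: complex where "\<epsilon> = (-1) ^ card {u\<in>\<sigma>. u < v}"
  have \<epsilon>: "\<epsilon> \<noteq> 0" by (simp add: \<epsilon>_def)
  have sub: "\<Delta> \<subseteq> ?\<Delta>'" by auto
  have fin: "finite \<sigma>" using ordered_complexD(1)[OF \<Delta>', of \<sigma>] by simp
  \<comment> \<open>Any coface of \<open>\<sigma>\<close> in \<open>\<Delta>\<close> would put
    \<open>\<sigma>\<close> into \<open>\<Delta>\<close> by downward closure; the new faces offer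
    only \<open>v\<close>.\<close>
  have "w = v" if "w \<notin> \<sigma>" "insert w \<sigma> \<in> ?\<Delta>'" for w
    using that v new ordered_complexD(3)[OF \<Delta>, of "insert w \<sigma>" \<sigma>] by auto
  then have cof: "{w. w \<notin> \<sigma> \<and> insert w \<sigma> \<in> ?\<Delta>'} = {v}" using v by auto
  have bd: "boundary ?\<Delta>' c \<sigma> = \<epsilon> * c ?\<tau>" for c
    unfolding boundary_def cof by (simp add: \<epsilon>_def)
  \<comment> \<open>Subtracting a multiple of \<open>boundary (elementary_chain ?\<tau>)\<close> moves a chain off the new pair.\<close>
  have push: "\<exists>d\<in>simplicial_chains ?\<Delta>' (q + 1).
      (\<lambda>\<rho>. c \<rho> - boundary ?\<Delta>' d \<rho>) \<in> simplicial_chains \<Delta> q"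
    if c: "c \<in> simplicial_chains ?\<Delta>' q" and "boundary ?\<Delta>' c \<sigma> = 0" for c q
  proof (cases "c \<sigma> = 0")
    case True
    moreover have "c ?\<tau> = 0" using that bd \<epsilon> by simp
    ultimately have "c \<in> simplicial_chains \<Delta> q" using c by (auto simp: simplicial_chains_def)
    then show ?thesis
      using lin_closed_zero[OF lin_closed_simplicial_chains] boundary_zero
      by (intro bexI[of _ "\<lambda>_. 0"]) (auto simp: boundary_zero)
  next
    case False
    then have "int (card \<sigma>) = q + 1" using c by (auto simp: simplicial_chains_def)
    then have card: "int (card ?\<tau>) = q + 2" using fin v by simp
    \<comment> \<open>The factor makes the boundary of \<open>d\<close> take the value
      \<open>c \<sigma>\<close> at \<open>\<sigma>\<close>; the leading 0 gives the shape of
      \<open>lin_closed_add_scaled\<close>.\<close>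
    define d where "d = (\<lambda>\<rho>. 0 + c \<sigma> / \<epsilon> * elementary_chain ?\<tau> \<rho>)"
    have d: "d \<in> simplicial_chains ?\<Delta>' (q + 1)"
      unfolding d_def using card
      by (intro lin_closed_add_scaled lin_closed_simplicial_chains
          lin_closed_zero[OF lin_closed_simplicial_chains] elementary_chain_in_chains) auto
    note bdc = boundary_in_chains[OF \<Delta>' d]
    let ?e = "\<lambda>\<rho>. c \<rho> - boundary ?\<Delta>' d \<rho>"
    have "?e \<in> simplicial_chains ?\<Delta>' q"
      by (intro lin_closed_diff[OF lin_closed_simplicial_chains] c bdc)
    moreover have "?e \<sigma> = 0"
      unfolding bd using \<epsilon> by (simp add: d_def elementary_chain_def)
    \<comment> \<open>By degree: \<open>c \<sigma> \<noteq> 0\<close> places \<open>\<sigma>\<close>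
      in degree \<open>q\<close>, hence \<open>?\<tau>\<close> in degree
      \<open>q + 1\<close>.\<close>
    moreover have "?e ?\<tau> = 0"
      using \<open>?e \<in> simplicial_chains ?\<Delta>' q\<close> card by (auto simp: simplicial_chains_def)
    ultimately have "?e \<in> simplicial_chains \<Delta> q" by (auto simp: simplicial_chains_def)
    with d show ?thesis by blast
  qed
  have bdr: "boundary ?\<Delta>' c = boundary \<Delta> c" if "c \<in> simplicial_chains \<Delta> q" for c q
    by (rule boundary_restrict[OF \<Delta>' sub that])
  have van: "z \<sigma> = 0" if "z \<in> simplicial_chains \<Delta> q" for z q
    using that new by (auto simp: simplicial_chains_def)
  obtain S where S: "quotient_basis (cycles \<Delta> p) (boundaries \<Delta> p) S" "card S = k"
    using k by (auto simp: betti_basis_def)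
  have "quotient_basis (cycles ?\<Delta>' p) (boundaries ?\<Delta>' p) S"
  proof (rule quotient_basis_transfer[OF lin_closed_cycles lin_closed_boundaries _ _ _ _ S(1)])
    show "cycles \<Delta> p \<subseteq> cycles ?\<Delta>' p"
      using bdr simplicial_chains_mono[OF sub] by (fastforce simp: cycles_def)
    show "boundaries \<Delta> p \<subseteq> boundaries ?\<Delta>' p"
    proof
      fix z assume "z \<in> boundaries \<Delta> p"
      then obtain c where "c \<in> simplicial_chains \<Delta> (p + 1)" "z = boundary \<Delta> c"
        by (auto simp: boundaries_def)
      then show "z \<in> boundaries ?\<Delta>' p"
        using bdr simplicial_chains_mono[OF sub] unfolding boundaries_def
        by (metis image_eqI subsetD)
    qed
  next
    fix z assume z: "z \<in> cycles ?\<Delta>' p"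
    then have zc: "z \<in> simplicial_chains ?\<Delta>' p" and z0: "boundary ?\<Delta>' z = (\<lambda>_. 0)"
      by (auto simp: cycles_def)
    then obtain d where d: "d \<in> simplicial_chains ?\<Delta>' (p + 1)"
      "(\<lambda>\<rho>. z \<rho> - boundary ?\<Delta>' d \<rho>) \<in> simplicial_chains \<Delta> p"
      using push[OF zc] by auto
    have "boundary \<Delta> (\<lambda>\<rho>. z \<rho> - boundary ?\<Delta>' d \<rho>) = (\<lambda>_. 0)"
      using bdr[OF d(2)] boundary_diff[of ?\<Delta>' z "boundary ?\<Delta>' d"] boundary_boundary[OF \<Delta>'] z0
      by simp
    then have "(\<lambda>\<rho>. z \<rho> - boundary ?\<Delta>' d \<rho>) \<in> cycles \<Delta> p" using d by (simp add: cycles_def)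
    moreover have "boundary ?\<Delta>' d \<in> boundaries ?\<Delta>' p" using d by (simp add: boundaries_def)
    ultimately show "\<exists>u\<in>cycles \<Delta> p. (\<lambda>x. z x - u x) \<in> boundaries ?\<Delta>' p"
      by (intro bexI[of _ "\<lambda>\<rho>. z \<rho> - boundary ?\<Delta>' d \<rho>"]) auto
  next
    show "cycles \<Delta> p \<inter> boundaries ?\<Delta>' p \<subseteq> boundaries \<Delta> p"
    proof
      fix z assume z: "z \<in> cycles \<Delta> p \<inter> boundaries ?\<Delta>' p"
      then obtain c where c: "c \<in> simplicial_chains ?\<Delta>' (p + 1)" "z = boundary ?\<Delta>' c"
        by (auto simp: boundaries_def)
      \<comment> \<open>This boundary is \<open>z\<close>, a chain of \<open>\<Delta>\<close>, so it
        vanishes at the new face and \<open>c\<close> can be pushed into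
        \<open>\<Delta>\<close>.\<close>
      have "boundary ?\<Delta>' c \<sigma> = 0" using z c van by (auto simp: cycles_def)
      then obtain d where d: "(\<lambda>\<rho>. c \<rho> - boundary ?\<Delta>' d \<rho>) \<in> simplicial_chains \<Delta> (p + 1)"
        using push c by blast
      have "boundary \<Delta> (\<lambda>\<rho>. c \<rho> - boundary ?\<Delta>' d \<rho>) = z"
        using bdr[OF d] boundary_diff[of ?\<Delta>' c "boundary ?\<Delta>' d"] boundary_boundary[OF \<Delta>'] c
        by simp
      then show "z \<in> boundaries \<Delta> p" using d by (auto simp: boundaries_def)
    qed
  qed
  then show ?thesis using S(2) by (auto simp: betti_basis_def)
qed

lemma cycles_add_cell_other_dim:
  assumes \<Delta>': "ordered_complex (insert \<sigma> \<Delta>)" and "int (card \<sigma>) \<noteq> p + 1"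
  shows "cycles (insert \<sigma> \<Delta>) p = cycles \<Delta> p"
proof -
  have "simplicial_chains (insert \<sigma> \<Delta>) p = simplicial_chains \<Delta> p"
    using assms(2) by (auto simp: simplicial_chains_def)
  then show ?thesis
    using boundary_restrict[OF \<Delta>' subset_insertI] by (fastforce simp: cycles_def)
qed

lemma boundaries_mono:
  assumes \<Delta>': "ordered_complex \<Delta>'" and "\<Delta> \<subseteq> \<Delta>'"
  shows "boundaries \<Delta> p \<subseteq> boundaries \<Delta>' p"
  using boundary_restrict[OF assms] simplicial_chains_mono[OF assms(2)]
  unfolding boundaries_def by (metis (no_types, lifting) image_mono image_cong)

text \<open>The boundary of the cell is a cycle of \<open>\<Delta>\<close>, hence by vanishing
  homology the boundary of a chain \<open>c\<close> of \<open>\<Delta>\<close>. The cell minus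
  \<open>c\<close> is a cycle with value 1 at \<open>\<sigma>\<close>, where all old cycles vanish,
  and there are no new \<open>(n + 1)\<close>-chains that could bound it.\<close>

lemma betti_basis_add_cell:
  assumes \<Delta>': "ordered_complex (insert \<sigma> \<Delta>)" and \<Delta>: "ordered_complex \<Delta>"
    and new: "\<sigma> \<notin> \<Delta>" and n: "int (card \<sigma>) = n + 1"
    and k: "betti_basis \<Delta> n k" and 0: "betti_basis \<Delta> (n - 1) 0"
  shows "betti_basis (insert \<sigma> \<Delta>) n (Suc k)"
proof -
  let ?\<Delta>' = "insert \<sigma> \<Delta>" let ?e = "elementary_chain \<sigma>"
  have sub: "\<Delta> \<subseteq> ?\<Delta>'" by auto
  have e: "?e \<in> simplicial_chains ?\<Delta>' n" using n by (intro elementary_chain_in_chains) auto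
  have "boundary ?\<Delta>' ?e \<in> cycles ?\<Delta>' (n - 1)"
    using boundary_in_chains[OF \<Delta>', of ?e "n - 1"] e boundary_boundary[OF \<Delta>', of ?e]
    by (simp add: cycles_def)
  also have "\<dots> = cycles \<Delta> (n - 1)" using n by (intro cycles_add_cell_other_dim[OF \<Delta>']) auto
  also have "\<dots> \<subseteq> boundaries \<Delta> (n - 1)" using 0 by (simp add: betti_basis_0_iff)
  finally obtain c where c: "c \<in> simplicial_chains \<Delta> n" "boundary ?\<Delta>' ?e = boundary \<Delta> c"
    by (auto simp: boundaries_def)
  define z where "z = (\<lambda>\<rho>. ?e \<rho> - c \<rho>)"
  have c': "c \<in> simplicial_chains ?\<Delta>' n" using c simplicial_chains_mono[OF sub] by blast
  have z: "z \<in> cycles ?\<Delta>' n"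
    unfolding cycles_def z_def
    using lin_closed_diff[OF lin_closed_simplicial_chains e c'] boundary_diff[of ?\<Delta>' ?e c] c(2)
      boundary_restrict[OF \<Delta>' sub c(1)] by simp
  have van: "d \<sigma> = 0" if "d \<in> simplicial_chains \<Delta> q" for d q
    using that new by (auto simp: simplicial_chains_def)
  have z1: "z \<sigma> = 1" using van[OF c(1)] by (simp add: z_def elementary_chain_def)
  obtain S where S: "quotient_basis (cycles \<Delta> n) (boundaries \<Delta> n) S" "card S = k"
    using k by (auto simp: betti_basis_def)
  have same: "simplicial_chains ?\<Delta>' (n + 1) = simplicial_chains \<Delta> (n + 1)"
    using n by (auto simp: simplicial_chains_def)
  have B: "boundaries ?\<Delta>' n = boundaries \<Delta> n"
    unfolding boundaries_def same using boundary_restrict[OF \<Delta>' sub] by (intro image_cong) auto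
  have cv: "d \<sigma> = 0" if "d \<in> cycles \<Delta> n" for d using that van by (auto simp: cycles_def)
  have "quotient_basis (cycles ?\<Delta>' n) (boundaries \<Delta> n) (insert z S)"
  proof (rule quotient_basis_insert[where y = \<sigma>, OF S(1) _ boundaries_subset_cycles[OF \<Delta>, of n] z z1])
    show "cycles \<Delta> n \<subseteq> cycles ?\<Delta>' n"
      using boundary_restrict[OF \<Delta>' sub] simplicial_chains_mono[OF sub] by (fastforce simp: cycles_def)
    show "d \<sigma> = 0" if "d \<in> cycles \<Delta> n" for d using that by (rule cv)
    fix d assume d: "d \<in> cycles ?\<Delta>' n"
    let ?f = "\<lambda>x. d x - d \<sigma> * z x"
    have f: "?f \<in> cycles ?\<Delta>' n"
      using lin_closed_add_scaled[OF lin_closed_cycles d z, of "- d \<sigma>"] by simp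
    moreover have "?f \<sigma> = 0" using z1 by simp
    ultimately have "?f \<in> simplicial_chains \<Delta> n" by (auto simp: cycles_def simplicial_chains_def)
    with f show "?f \<in> cycles \<Delta> n"
      using boundary_restrict[OF \<Delta>' sub] by (auto simp: cycles_def)
  qed
  moreover have "z \<notin> S" using S(1) cv z1 by (fastforce simp: quotient_basis_def)
  moreover have "finite S" using S(1) by (simp add: quotient_basis_def)
  ultimately show ?thesis unfolding betti_basis_def B using S(2)
    by (intro exI[of _ "insert z S"]) auto
qed

subsection \<open>Building complexes by collapses and cells of one dimension\<close>

text \<open>In \<open>builds n A k \<Delta>\<close>, the number \<open>k\<close> counts the attached cells of dimension \<open>n\<close>. The void complex
  \<open>{}\<close>, without the empty face, is a legitimate start: the first pair added to it consists of
  the empty face and a vertex.\<close>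

inductive builds :: "int \<Rightarrow> 'b set set \<Rightarrow> nat \<Rightarrow> 'b set set \<Rightarrow> bool" for n A where
  start: "builds n A 0 A"
| pair: "builds n A k \<Delta> \<Longrightarrow> finite \<sigma> \<Longrightarrow> v \<notin> \<sigma> \<Longrightarrow> \<sigma> \<notin> \<Delta> \<Longrightarrow> insert v \<sigma> \<notin> \<Delta> \<Longrightarrow>
    (\<And>\<rho>. \<rho> \<subset> insert v \<sigma> \<Longrightarrow> \<rho> \<noteq> \<sigma> \<Longrightarrow> \<rho> \<in> \<Delta>) \<Longrightarrow>
    builds n A k (insert (insert v \<sigma>) (insert \<sigma> \<Delta>))"
| cell: "builds n A k \<Delta> \<Longrightarrow> finite \<sigma> \<Longrightarrow> int (card \<sigma>) = n + 1 \<Longrightarrow> \<sigma> \<notin> \<Delta> \<Longrightarrow>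
    (\<And>\<rho>. \<rho> \<subset> \<sigma> \<Longrightarrow> \<rho> \<in> \<Delta>) \<Longrightarrow> builds n A (Suc k) (insert \<sigma> \<Delta>)"

lemma builds_trans:
  assumes "builds n B l C" and "builds n A k B"
  shows "builds n A (k + l) C"
  using assms
proof (induction rule: builds.induct)
  case (pair l \<Delta> \<sigma> v)
  then show ?case by (intro builds.pair) auto
next
  case (cell l \<Delta> \<sigma>)
  then show ?case unfolding add_Suc_right by (intro builds.cell) auto
qed simp

lemma builds_finite: "builds n A k \<Delta> \<Longrightarrow> finite A \<Longrightarrow> finite \<Delta>"
  by (induction rule: builds.induct) auto

lemma builds_downward_closed:
  assumes "builds n A k \<Delta>" and "\<And>\<sigma> \<rho>. \<sigma> \<in> A \<Longrightarrow> \<rho> \<subseteq> \<sigma> \<Longrightarrow> \<rho> \<in> A"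
  shows "\<sigma> \<in> \<Delta> \<Longrightarrow> \<rho> \<subseteq> \<sigma> \<Longrightarrow> \<rho> \<in> \<Delta>"
  using assms
proof (induction arbitrary: \<sigma> \<rho> rule: builds.induct)
  case (pair k \<Delta> \<tau> v)
  show ?case
  proof (cases "\<rho> \<subset> insert v \<tau> \<and> \<rho> \<noteq> \<tau>")
    case False
    then show ?thesis using pair by (metis insert_iff psubsetI subset_insertI2)
  qed (use pair in blast)
next
  case (cell k \<Delta> \<tau>)
  then show ?case by (metis insert_iff psubsetI)
qed blast

lemma builds_ordered_complex:
  assumes "builds n {} k \<Delta>" and "\<And>\<sigma>. \<sigma> \<in> \<Delta> \<Longrightarrow> finite \<sigma> \<and> Complete_Partial_Order.chain (\<le>) \<sigma>"
  shows "ordered_complex \<Delta>"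
  unfolding ordered_complex_def
proof (intro conjI ballI allI impI)
  show "finite \<Delta>" using builds_finite[OF assms(1)] by simp
  fix \<sigma> assume \<sigma>: "\<sigma> \<in> \<Delta>"
  then show "finite \<sigma>" "Complete_Partial_Order.chain (\<le>) \<sigma>" using assms(2) by blast+
  fix \<rho> assume "\<rho> \<subseteq> \<sigma>"
  then show "\<rho> \<in> \<Delta>" using builds_downward_closed[OF assms(1) _ \<sigma>] by simp
qed

text \<open>All degrees are carried through the induction because the cell step at \<open>n\<close>
  uses the vanishing at \<open>n - 1\<close>. In a degree other than \<open>n\<close> a cell leaves
  the cycles unchanged and can only enlarge the boundaries, so vanishing persists.\<close>

lemma builds_betti_basis:
  assumes "builds n {} k \<Delta>" and "\<And>\<sigma>. \<sigma> \<in> \<Delta> \<Longrightarrow> finite \<sigma> \<and> Complete_Partial_Order.chain (\<le>) \<sigma>"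
  shows "betti_basis \<Delta> i (if i = n then k else 0)"
  using assms
proof (induction arbitrary: i rule: builds.induct)
  case start
  have "v = (\<lambda>_. 0)" if "v \<in> cycles {} i" for v :: "'a set \<Rightarrow> complex"
    using that by (auto simp: cycles_def simplicial_chains_def)
  then have "cycles {} i \<subseteq> boundaries ({} :: 'a set set) i"
    using lin_closed_zero[OF lin_closed_boundaries] by auto
  then show ?case by (simp add: betti_basis_0_iff)
next
  case (pair k \<Delta> \<sigma> v)
  have oc: "ordered_complex \<Theta>" if "builds n {} j \<Theta>" "\<Theta> \<subseteq> insert (insert v \<sigma>) (insert \<sigma> \<Delta>)" for j \<Theta>
    using builds_ordered_complex[OF that(1)] pair.prems that(2) by blast
  show ?case
    by (rule betti_basis_free_pair[OF oc[OF builds.pair[OF pair.hyps]] oc[OF pair.hyps(1)]])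
      (use pair in auto)
next
  case (cell k \<Delta> \<sigma>)
  have oc: "ordered_complex \<Theta>" if "builds n {} j \<Theta>" "\<Theta> \<subseteq> insert \<sigma> \<Delta>" for j \<Theta>
    using builds_ordered_complex[OF that(1)] cell.prems that(2) by blast
  note oc' = oc[OF builds.cell[OF cell.hyps]] and oc = oc[OF cell.hyps(1)]
  show ?case
  proof (cases "i = n")
    case True
    then show ?thesis
      using betti_basis_add_cell[OF oc' oc cell.hyps(4,3), of k] cell.IH[of n] cell.IH[of "n - 1"]
        cell.prems by auto
  next
    case False
    then have "cycles (insert \<sigma> \<Delta>) i = cycles \<Delta> i"
      using cell.hyps(3) by (intro cycles_add_cell_other_dim oc') auto
    then show ?thesis
      using False cell.IH[of i] cell.prems boundaries_mono[OF oc', of \<Delta> i]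
      by (auto simp: betti_basis_0_iff)
  qed
qed

text \<open>Toggling \<open>v\<close> matches the faces in \<open>D\<close> perfectly. A pair whose
  upper face has maximal cardinality can be added last, as nothing else in \<open>D\<close> lies
  above its lower face.\<close>

lemma builds_collapse:
  assumes "finite D" and "D \<inter> \<Delta> = {}" and "\<And>\<sigma>. \<sigma> \<in> D \<Longrightarrow> finite \<sigma>"
    and "\<And>\<sigma>. \<sigma> \<in> D \<Longrightarrow> insert v \<sigma> \<in> D \<and> \<sigma> - {v} \<in> D"
    and "\<And>\<sigma> \<rho>. \<sigma> \<in> \<Delta> \<union> D \<Longrightarrow> \<rho> \<subseteq> \<sigma> \<Longrightarrow> \<rho> \<in> \<Delta> \<union> D"
    and "\<And>\<sigma> \<rho>. \<sigma> \<in> \<Delta> \<Longrightarrow> \<rho> \<subseteq> \<sigma> \<Longrightarrow> \<rho> \<in> \<Delta>"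
  shows "builds n \<Delta> 0 (\<Delta> \<union> D)"
  using assms(1-5)
proof (induction "card D" arbitrary: D rule: less_induct)
  case less
  show ?case
  proof (cases "D = {}")
    case True
    then show ?thesis by (simp add: builds.start)
  next
    case False
    obtain \<tau> where \<tau>: "\<tau> \<in> D" and max: "\<And>\<rho>. \<rho> \<in> D \<Longrightarrow> card \<rho> \<le> card \<tau>"
      using Max_in[of "card ` D"] Max_ge[of "card ` D"] False less.prems(1)
      by (metis (no_types, lifting) finite_imageI imageE image_eqI image_is_empty)
    define \<sigma> where "\<sigma> = \<tau> - {v}"
    have fin: "finite \<tau>" using \<tau> less.prems(3) by blast
    have "v \<in> \<tau>"
    proof (rule ccontr)
      assume "v \<notin> \<tau>"
      then have "card (insert v \<tau>) > card \<tau>" using fin by simp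
      with max[of "insert v \<tau>"] less.prems(4)[OF \<tau>] show False by simp
    qed
    then have ins: "insert v \<sigma> = \<tau>" and v: "v \<notin> \<sigma>" by (auto simp: \<sigma>_def)
    have \<sigma>: "\<sigma> \<in> D" using less.prems(4)[OF \<tau>] by (simp add: \<sigma>_def)
    \<comment> \<open>Adding \<open>v\<close> to such a face gives a superset of
      \<open>\<tau>\<close> in \<open>D\<close>; by maximality it is \<open>\<tau>\<close>
      itself.\<close>
    have top: "\<rho> = \<sigma> \<or> \<rho> = \<tau>" if "\<rho> \<in> D" "\<sigma> \<subseteq> \<rho>" for \<rho>
    proof -
      have vD: "insert v \<rho> \<in> D" using less.prems(4)[OF that(1)] by blast
      note max[OF vD] less.prems(3)[OF vD]
      moreover have "\<tau> \<subseteq> insert v \<rho>" using that(2) ins by auto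
      ultimately have "insert v \<rho> = \<tau>" using card_seteq by blast
      then show ?thesis using that(2) v ins by auto
    qed
    let ?D = "D - {\<sigma>, \<tau>}"
    have "builds n \<Delta> 0 (\<Delta> \<union> ?D)"
    proof (rule less.hyps)
      show "card ?D < card D"
        using \<sigma> less.prems(1) by (intro psubset_card_mono) auto
      fix \<rho> assume \<rho>: "\<rho> \<in> ?D"
      then show "insert v \<rho> \<in> ?D \<and> \<rho> - {v} \<in> ?D"
        using less.prems(4)[of \<rho>] ins v by (auto simp: \<sigma>_def)
    next
      fix \<rho> \<rho>' assume \<rho>: "\<rho> \<in> \<Delta> \<union> ?D" "\<rho>' \<subseteq> \<rho>"
      then have in': "\<rho>' \<in> \<Delta> \<union> D" using less.prems(5)[of \<rho> \<rho>'] by blast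
      moreover have "\<rho>' \<noteq> \<sigma> \<and> \<rho>' \<noteq> \<tau>"
      proof (cases "\<rho> \<in> \<Delta>")
        case True
        then have "\<rho>' \<in> \<Delta>" using \<rho>(2) assms(6) by blast
        then show ?thesis using \<sigma> \<tau> less.prems(2) by auto
      next
        case False
        then have "\<not> \<sigma> \<subseteq> \<rho>" using \<rho> top[of \<rho>] by auto
        then show ?thesis using \<rho>(2) ins by auto
      qed
      ultimately show "\<rho>' \<in> \<Delta> \<union> ?D" by auto
    qed (use less.prems in auto)
    then have "builds n \<Delta> 0 (insert (insert v \<sigma>) (insert \<sigma> (\<Delta> \<union> ?D)))"
    proof (rule builds.pair)
      fix \<rho> assume "\<rho> \<subset> insert v \<sigma>" "\<rho> \<noteq> \<sigma>"
      then show "\<rho> \<in> \<Delta> \<union> ?D" using less.prems(5)[of \<tau> \<rho>] \<tau> ins by auto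
    qed (use v fin less.prems(2) \<sigma> \<tau> ins in \<open>auto simp: \<sigma>_def\<close>)
    moreover have "insert (insert v \<sigma>) (insert \<sigma> (\<Delta> \<union> ?D)) = \<Delta> \<union> D"
      using \<sigma> \<tau> ins by auto
    ultimately show ?thesis by simp
  qed
qed

text \<open>Adjoining \<open>p\<close> to every face turns each step of a construction of
  \<open>L\<close> into a step one dimension higher on top of \<open>M\<close>. The proper faces
  omitting \<open>p\<close> are faces of \<open>L\<close> and hence already present in
  \<open>M\<close>.\<close>

lemma builds_cone:
  assumes "builds n A k L" and "p \<notin> \<Union>M" and "p \<notin> \<Union>L" and "L \<subseteq> M"
  shows "builds (n + 1) (M \<union> insert p ` A) k (M \<union> insert p ` L)"
  using assms
proof (induction rule: builds.induct)
  case start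
  show ?case by (rule builds.start)
next
  case (pair k \<Delta> \<sigma> v)
  have p: "p \<notin> insert v \<sigma>" "p \<notin> \<Union>\<Delta>" using pair.prems by auto
  have new: "insert p \<rho> \<notin> M \<union> insert p ` \<Delta>" if "\<rho> \<notin> \<Delta>" "p \<notin> \<rho>" for \<rho>
  proof
    assume "insert p \<rho> \<in> M \<union> insert p ` \<Delta>"
    then obtain \<rho>' where "\<rho>' \<in> \<Delta>" "insert p \<rho> = insert p \<rho>'" using pair.prems(1) by auto
    then show False using that p(2) by (metis UnionI insert_ident)
  qed
  have "builds (n + 1) (M \<union> insert p ` A) k
    (insert (insert v (insert p \<sigma>)) (insert (insert p \<sigma>) (M \<union> insert p ` \<Delta>)))"
  proof (rule builds.pair)
    show "builds (n + 1) (M \<union> insert p ` A) k (M \<union> insert p ` \<Delta>)"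
      using pair p by blast
    show "insert v (insert p \<sigma>) \<notin> M \<union> insert p ` \<Delta>"
      using new[of "insert v \<sigma>"] p pair.hyps by (simp add: insert_commute)
    show "insert p \<sigma> \<notin> M \<union> insert p ` \<Delta>" using new[of \<sigma>] p pair.hyps by simp
    fix \<rho> assume \<rho>: "\<rho> \<subset> insert v (insert p \<sigma>)" "\<rho> \<noteq> insert p \<sigma>"
    show "\<rho> \<in> M \<union> insert p ` \<Delta>"
    proof (cases "p \<in> \<rho>")
      case True
      then have "\<rho> - {p} \<subset> insert v \<sigma>" "\<rho> - {p} \<noteq> \<sigma>" using \<rho> by auto
      then have "\<rho> - {p} \<in> \<Delta>" by (rule pair.hyps)
      then show ?thesis using True by (metis UnI2 imageI insert_Diff)
    next
      case False
      then have "\<rho> \<subseteq> insert v \<sigma>" using \<rho> by auto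
      then have "\<rho> \<in> insert (insert v \<sigma>) (insert \<sigma> \<Delta>)" using pair.hyps(6)[of \<rho>] by auto
      then show ?thesis using pair.prems(3) by blast
    qed
  qed (use p pair.hyps in auto)
  then show ?case by (simp add: insert_commute)
next
  case (cell k \<Delta> \<sigma>)
  have p: "p \<notin> \<sigma>" "p \<notin> \<Union>\<Delta>" using cell.prems by auto
  have "builds (n + 1) (M \<union> insert p ` A) (Suc k) (insert (insert p \<sigma>) (M \<union> insert p ` \<Delta>))"
  proof (rule builds.cell)
    show "builds (n + 1) (M \<union> insert p ` A) k (M \<union> insert p ` \<Delta>)"
      using cell p by blast
    show "insert p \<sigma> \<notin> M \<union> insert p ` \<Delta>"
    proof
      assume "insert p \<sigma> \<in> M \<union> insert p ` \<Delta>"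
      then obtain \<rho>' where "\<rho>' \<in> \<Delta>" "insert p \<sigma> = insert p \<rho>'" using cell.prems(1) by auto
      then show False using cell.hyps(4) p by (metis UnionI insert_ident)
    qed
    fix \<rho> assume \<rho>: "\<rho> \<subset> insert p \<sigma>"
    show "\<rho> \<in> M \<union> insert p ` \<Delta>"
    proof (cases "p \<in> \<rho>")
      case True
      then have "\<rho> - {p} \<subset> \<sigma>" using \<rho> by auto
      then have "\<rho> - {p} \<in> \<Delta>" by (rule cell.hyps)
      then show ?thesis using True by (metis UnI2 imageI insert_Diff)
    next
      case False
      then have "\<rho> \<subseteq> \<sigma>" using \<rho> by auto
      then have "\<rho> \<in> insert \<sigma> \<Delta>" using cell.hyps(5)[of \<rho>] by auto
      then show ?thesis using cell.prems(3) by blast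
    qed
  qed (use p cell.hyps in auto)
  then show ?case by simp
qed

text \<open>Injectivity on vertices suffices; the map may reverse their order, as it will for
  \<open>Inter\<close>.\<close>

lemma builds_image:
  assumes "builds n A k \<Delta>" and "inj_on g (\<Union>\<Delta>)"
  shows "builds n (image g ` A) k (image g ` \<Delta>)"
  using assms
proof (induction rule: builds.induct)
  case start
  show ?case by (rule builds.start)
next
  case (pair k \<Delta> \<sigma> v)
  have inj: "inj_on g (\<Union>\<Delta>)" by (rule inj_on_subset[OF pair.prems]) auto
  have new: "g ` \<rho> \<notin> image g ` \<Delta>" if "\<rho> \<notin> \<Delta>" "\<rho> \<subseteq> insert v \<sigma>" for \<rho>
  proof
    assume "g ` \<rho> \<in> image g ` \<Delta>"
    then obtain \<rho>' where "\<rho>' \<in> \<Delta>" "g ` \<rho> = g ` \<rho>'" by auto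
    then show False using that inj_on_image_eq_iff[OF pair.prems, of \<rho> \<rho>'] by auto
  qed
  have "builds n (image g ` A) k (insert (insert (g v) (g ` \<sigma>)) (insert (g ` \<sigma>) (image g ` \<Delta>)))"
  proof (rule builds.pair)
    show "builds n (image g ` A) k (image g ` \<Delta>)" using pair.IH[OF inj] .
    show "g v \<notin> g ` \<sigma>" using pair.hyps(3) pair.prems by (auto simp: inj_on_def)
    show "g ` \<sigma> \<notin> image g ` \<Delta>" using new[of \<sigma>] pair.hyps by auto
    show "insert (g v) (g ` \<sigma>) \<notin> image g ` \<Delta>" using new[of "insert v \<sigma>"] pair.hyps by auto
    fix \<rho> assume \<rho>: "\<rho> \<subset> insert (g v) (g ` \<sigma>)" "\<rho> \<noteq> g ` \<sigma>"
    then obtain \<rho>' where "\<rho>' \<subseteq> insert v \<sigma>" "\<rho> = g ` \<rho>'"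
      by (metis image_insert psubset_imp_subset subset_imageE)
    with \<rho> have "\<rho>' \<subset> insert v \<sigma>" "\<rho>' \<noteq> \<sigma>" by auto
    then show "\<rho> \<in> image g ` \<Delta>" using pair.hyps(6) \<open>\<rho> = g ` \<rho>'\<close> by blast
  qed (use pair.hyps in auto)
  then show ?case by simp
next
  case (cell k \<Delta> \<sigma>)
  have inj: "inj_on g (\<Union>\<Delta>)" "inj_on g \<sigma>" by (rule inj_on_subset[OF cell.prems], auto)+
  have "builds n (image g ` A) (Suc k) (insert (g ` \<sigma>) (image g ` \<Delta>))"
  proof (rule builds.cell)
    show "builds n (image g ` A) k (image g ` \<Delta>)" using cell.IH[OF inj(1)] .
    show "int (card (g ` \<sigma>)) = n + 1" using card_image[OF inj(2)] cell.hyps by simp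
    show "g ` \<sigma> \<notin> image g ` \<Delta>"
    proof
      assume "g ` \<sigma> \<in> image g ` \<Delta>"
      then obtain \<rho>' where "\<rho>' \<in> \<Delta>" "g ` \<sigma> = g ` \<rho>'" by auto
      then show False using cell.hyps(4) inj_on_image_eq_iff[OF cell.prems, of \<sigma> \<rho>'] by auto
    qed
    fix \<rho> assume \<rho>: "\<rho> \<subset> g ` \<sigma>"
    then obtain \<rho>' where "\<rho>' \<subseteq> \<sigma>" "\<rho> = g ` \<rho>'"
      by (metis psubset_imp_subset subset_imageE)
    with \<rho> have "\<rho>' \<subset> \<sigma>" by auto
    then show "\<rho> \<in> image g ` \<Delta>" using cell.hyps(5) \<open>\<rho> = g ` \<rho>'\<close> by blast
  qed (use cell.hyps in auto)
  then show ?case by simp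
qed

subsection \<open>Order complexes of posets of partial transversals\<close>

text \<open>Chains see the order only through this symmetric relation, so a poset and its dual have
  the same order complex.\<close>

definition comparable :: "'b set \<Rightarrow> 'b set \<Rightarrow> bool"
  where "comparable F F' \<longleftrightarrow> F \<subseteq> F' \<or> F' \<subseteq> F"

lemma order_complex_mem_iff:
  "\<sigma> \<in> order_complex P \<longleftrightarrow> finite \<sigma> \<and> \<sigma> \<subseteq> P \<and> (\<forall>F\<in>\<sigma>. \<forall>F'\<in>\<sigma>. comparable F F')"
  by (auto simp: order_complex_def chain_def comparable_def)

lemma order_complex_downward_closed:
  "\<sigma> \<in> order_complex P \<Longrightarrow> \<rho> \<subseteq> \<sigma> \<Longrightarrow> \<rho> \<in> order_complex P"
  unfolding order_complex_def by (blast intro: finite_subset chain_subset)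

lemma finite_order_complex: "finite P \<Longrightarrow> finite (order_complex P)"
  by (rule finite_subset[of _ "Pow P"]) (auto simp: order_complex_def)

lemma order_complex_insert:
  assumes "p \<notin> P"
  shows "order_complex (insert p P) =
    order_complex P \<union> insert p ` order_complex {F\<in>P. comparable F p}"
proof (intro equalityI subsetI)
  fix \<sigma> assume \<sigma>: "\<sigma> \<in> order_complex (insert p P)"
  show "\<sigma> \<in> order_complex P \<union> insert p ` order_complex {F\<in>P. comparable F p}"
  proof (cases "p \<in> \<sigma>")
    case True
    then have "\<sigma> - {p} \<in> order_complex {F\<in>P. comparable F p}"
      using \<sigma> by (auto simp: order_complex_mem_iff)
    moreover have "\<sigma> = insert p (\<sigma> - {p})" using True by auto
    ultimately show ?thesis by blast
  next
    case False
    then show ?thesis using \<sigma> by (auto simp: order_complex_mem_iff)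
  qed
next
  fix \<sigma> assume "\<sigma> \<in> order_complex P \<union> insert p ` order_complex {F\<in>P. comparable F p}"
  then show "\<sigma> \<in> order_complex (insert p P)"
  proof
    assume "\<sigma> \<in> order_complex P"
    then show ?thesis by (auto simp: order_complex_mem_iff)
  next
    assume "\<sigma> \<in> insert p ` order_complex {F\<in>P. comparable F p}"
    then obtain \<rho> where \<rho>: "\<rho> \<in> order_complex {F\<in>P. comparable F p}" "\<sigma> = insert p \<rho>"
      by blast
    have "comparable F p \<and> comparable p F" if "F \<in> \<rho>" for F
      using \<rho>(1) that by (auto simp: order_complex_mem_iff comparable_def)
    then show ?thesis using \<rho> by (auto simp: order_complex_mem_iff comparable_def)
  qed
qed

text \<open>By \<open>dom\<close> the link of \<open>p\<close> is a cone with apex \<open>q\<close>,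
  so toggling \<open>q\<close> matches the faces through \<open>p\<close>.\<close>

lemma builds_order_complex_dominated:
  assumes "finite P" and "p \<notin> P" and q: "q \<in> P" "comparable q p"
    and dom: "\<And>r. r \<in> P \<Longrightarrow> comparable r p \<Longrightarrow> comparable r q"
  shows "builds n (order_complex P) 0 (order_complex (insert p P))"
  unfolding order_complex_insert[OF assms(2)]
proof (rule builds_collapse[where v = q])
  let ?L = "order_complex {F\<in>P. comparable F p}"
  show "finite (insert p ` ?L)" using assms(1) by (simp add: finite_order_complex)
  show "insert p ` ?L \<inter> order_complex P = {}"
    using assms(2) by (auto simp: order_complex_mem_iff)
  fix \<sigma> assume "\<sigma> \<in> insert p ` ?L"
  then obtain \<rho> where \<rho>: "\<rho> \<in> ?L" "\<sigma> = insert p \<rho>" by blast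
  then show "finite \<sigma>" by (auto simp: order_complex_mem_iff)
  have "insert q \<rho> \<in> ?L"
    using \<rho>(1) q dom by (auto simp: order_complex_mem_iff comparable_def)
  moreover have "insert q \<sigma> = insert p (insert q \<rho>)" using \<rho> by auto
  moreover have "\<rho> - {q} \<in> ?L" by (rule order_complex_downward_closed[OF \<rho>(1)]) auto
  moreover have "\<sigma> - {q} = insert p (\<rho> - {q})" using \<rho> assms(2) q(1) by auto
  ultimately show "insert q \<sigma> \<in> insert p ` ?L \<and> \<sigma> - {q} \<in> insert p ` ?L" by blast
next
  fix \<sigma> \<rho> assume "\<sigma> \<in> order_complex P" "\<rho> \<subseteq> \<sigma>"
  then show "\<rho> \<in> order_complex P" by (rule order_complex_downward_closed)
next
  fix \<sigma> \<rho>
  show "\<sigma> \<in> order_complex P \<union> insert p ` order_complex {F\<in>P. comparable F p} \<Longrightarrow> \<rho> \<subseteq> \<sigma> \<Longrightarrow>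
    \<rho> \<in> order_complex P \<union> insert p ` order_complex {F\<in>P. comparable F p}"
    unfolding order_complex_insert[OF assms(2), symmetric] by (rule order_complex_downward_closed)
qed

text \<open>The elements of \<open>E\<close> are added in increasing order of \<open>f\<close>.\<close>

lemma builds_order_complex_retract:
  fixes f :: "'b set \<Rightarrow> nat"
  assumes "finite P" and "finite E" and "P \<inter> E = {}"
    and q: "\<And>e. e \<in> E \<Longrightarrow> q e \<in> P \<and> comparable (q e) e"
    and domP: "\<And>e r. e \<in> E \<Longrightarrow> r \<in> P \<Longrightarrow> comparable r e \<Longrightarrow> comparable r (q e)"
    and domE: "\<And>e r. e \<in> E \<Longrightarrow> r \<in> E \<Longrightarrow> r \<noteq> e \<Longrightarrow> f r \<le> f e \<Longrightarrow> comparable r e \<Longrightarrow> comparable r (q e)"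
  shows "builds n (order_complex P) 0 (order_complex (P \<union> E))"
  using assms(2-)
proof (induction "card E" arbitrary: E)
  case 0
  then show ?case by (simp add: builds.start)
next
  case (Suc k)
  then have "E \<noteq> {}" by auto
  \<comment> \<open>Added last; since \<open>f\<close> is largest at \<open>p\<close>, the
    hypothesis \<open>domE\<close> applies to every element of \<open>E\<close> already
    present.\<close>
  then obtain p where p: "p \<in> E" and max: "\<And>r. r \<in> E \<Longrightarrow> f r \<le> f p"
    using Max_in[of "f ` E"] Max_ge[of "f ` E"] Suc.prems(1)
    by (metis (no_types, lifting) finite_imageI imageE image_eqI image_is_empty)
  let ?E = "E - {p}"
  have 1: "builds n (order_complex P) 0 (order_complex (P \<union> ?E))"
    using Suc.prems Suc.hyps(2) p by (intro Suc.hyps(1)) auto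
  have 2: "builds n (order_complex (P \<union> ?E)) 0 (order_complex (insert p (P \<union> ?E)))"
  proof (rule builds_order_complex_dominated[where q = "q p"])
    fix r assume r: "r \<in> P \<union> ?E" "comparable r p"
    then show "comparable r (q p)"
      using Suc.prems(4)[OF p, of r] Suc.prems(5)[OF p, of r] max[of r] by blast
  qed (use Suc.prems p assms(1) in auto)
  have "insert p (P \<union> ?E) = P \<union> E" using p by auto
  then show ?case using builds_trans[OF 2 1] by simp
qed

text \<open>The faces of a join of discrete sets, translated by a fixed set \<open>h\<close>: this makes the link of a
  minimal element again a poset of this form, without an isomorphism.\<close>

definition transversals :: "'b set \<Rightarrow> 'b set set \<Rightarrow> 'b set set"
  where "transversals h \<X> = {F. h \<subset> F \<and> F \<subseteq> h \<union> \<Union>\<X> \<and>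
    (\<forall>B\<in>\<X>. \<forall>x\<in>F \<inter> B. \<forall>y\<in>F \<inter> B. x = y)}"

lemma finite_transversals: "finite h \<Longrightarrow> finite (\<Union>\<X>) \<Longrightarrow> finite (transversals h \<X>)"
  by (rule finite_subset[of _ "Pow (h \<union> \<Union>\<X>)"]) (auto simp: transversals_def)

text \<open>Describes the strict upper set of the minimal transversal \<open>insert x h\<close>:
  once \<open>x\<close> is chosen the block \<open>B\<close> is exhausted, and \<open>x\<close>
  joins the fixed part.\<close>

lemma transversals_insert_vertex:
  assumes x: "x \<in> B" and B: "B \<in> \<X>" and disj: "pairwise disjnt \<X>" and h: "h \<inter> \<Union>\<X> = {}"
  shows "transversals (insert x h) (\<X> - {B}) = {F \<in> transversals h \<X>. x \<in> F \<and> F \<noteq> insert x h}"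
proof (intro equalityI subsetI)
  fix F assume F: "F \<in> transversals (insert x h) (\<X> - {B})"
  have BB: "B \<inter> C = {}" if "C \<in> \<X>" "C \<noteq> B" for C
    using disj B that by (auto simp: pairwise_def disjnt_def)
  have "y = x" if "y \<in> F" "y \<in> B" for y
  proof -
    have "y \<in> insert x h \<union> \<Union>(\<X> - {B})" using F that(1) by (auto simp: transversals_def)
    moreover have "y \<notin> h" using h B that(2) by blast
    ultimately show ?thesis using BB that(2) by blast
  qed
  moreover have "\<forall>C\<in>\<X> - {B}. \<forall>y\<in>F \<inter> C. \<forall>z\<in>F \<inter> C. y = z"
    using F by (simp add: transversals_def)
  ultimately have "\<forall>C\<in>\<X>. \<forall>y\<in>F \<inter> C. \<forall>z\<in>F \<inter> C. y = z"
    by blast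
  then show "F \<in> {F \<in> transversals h \<X>. x \<in> F \<and> F \<noteq> insert x h}"
    using F x B h by (auto simp: transversals_def)
next
  fix F assume F: "F \<in> {F \<in> transversals h \<X>. x \<in> F \<and> F \<noteq> insert x h}"
  then have "y = x" if "y \<in> F" "y \<in> B" for y using that x B by (auto simp: transversals_def)
  then have "F \<subseteq> insert x h \<union> \<Union>(\<X> - {B})" using F by (fastforce simp: transversals_def)
  then show "F \<in> transversals (insert x h) (\<X> - {B})" using F by (auto simp: transversals_def)
qed

text \<open>Fix a block \<open>B\<close> and \<open>x0 \<in> B\<close>. The transversals through \<open>x0\<close> form a cone. Those missing \<open>B\<close>,
  added in increasing order, retract by inserting \<open>x0\<close>; those through another \<open>x \<in> B\<close> and some
  further point, added in decreasing order, retract by deleting \<open>x\<close>. Finally each minimal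
  transversal \<open>insert x h\<close> with \<open>x \<noteq> x0\<close> contributes the cone over its link, which is the order
  complex for the remaining blocks.\<close>

lemma builds_transversals:
  assumes "finite \<X>" and "\<And>B. B \<in> \<X> \<Longrightarrow> finite B \<and> B \<noteq> {}" and "pairwise disjnt \<X>"
    and "finite h" and "h \<inter> \<Union>\<X> = {}"
  shows "builds (int (card \<X>) - 1) {} (\<Prod>B\<in>\<X>. card B - 1) (order_complex (transversals h \<X>))"
  using assms
proof (induction "card \<X>" arbitrary: \<X> h)
  case 0
  then have "transversals h \<X> = {}" by (auto simp: transversals_def)
  then have "order_complex (transversals h \<X>) = {{}}" by (auto simp: order_complex_mem_iff)
  \<comment> \<open>The complex with only the empty face arises from the void complex by one cell of
    dimension \<open>-1\<close>, in accordance with the empty product.\<close>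
  moreover have "builds (-1) {} (Suc 0) {{} :: 'a set set}"
    by (intro builds.cell builds.start) auto
  ultimately show ?case using 0 by simp
next
  case (Suc m)
  then obtain B where B: "B \<in> \<X>" by fastforce
  obtain x0 where x0: "x0 \<in> B" using Suc.prems(2) B by blast
  let ?T = "transversals h \<X>" let ?n = "int (card \<X>) - 1"
  have fin: "finite ?T" and finU: "finite (\<Union>\<X>)"
    using Suc.prems by (auto intro!: finite_transversals)
  have finF: "finite F" if "F \<in> ?T" for F
    using that finU Suc.prems(4) by (auto simp: transversals_def intro: finite_subset[of _ "h \<union> \<Union>\<X>"])
  have hB: "h \<inter> B = {}" using Suc.prems(5) B by blast
  have one: "x = y" if "F \<in> ?T" "x \<in> F" "y \<in> F" "x \<in> B" "y \<in> B" for F x y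
    using that B by (auto simp: transversals_def)
  have addx: "insert x F \<in> ?T" if "F \<in> insert h ?T" "F \<inter> B = {}" "x \<in> B" for F x
  proof -
    have C: "x \<notin> C" if "C \<in> \<X>" "C \<noteq> B" for C
      using that \<open>x \<in> B\<close> B Suc.prems(3) by (auto simp: pairwise_def disjnt_def)
    have "h \<subseteq> F" "F \<subseteq> h \<union> \<Union>\<X>" using that(1) by (auto simp: transversals_def)
    moreover have "\<forall>y\<in>F \<inter> C. \<forall>z\<in>F \<inter> C. y = z" if "C \<in> \<X>" for C
      using \<open>F \<in> insert h ?T\<close> Suc.prems(5) that by (auto simp: transversals_def)
    then have "\<forall>y\<in>insert x F \<inter> C. \<forall>z\<in>insert x F \<inter> C. y = z" if "C \<in> \<X>" for C
      using C[OF that] that \<open>F \<inter> B = {}\<close> by (cases "C = B") auto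
    moreover have "x \<notin> h" using hB that(3) by blast
    ultimately show ?thesis using that(3) B unfolding transversals_def by blast
  qed
  define P0 where "P0 = {F\<in>?T. x0 \<in> F}"
  define P1 where "P1 = {F\<in>?T. F \<inter> B = {}}"
  define P2 where "P2 = {F\<in>?T. \<exists>x\<in>B - {x0}. x \<in> F \<and> F \<noteq> insert x h}"
  have finP: "finite P0" "finite P1" "finite P2" using fin by (auto simp: P0_def P1_def P2_def)
  have a: "insert x0 h \<in> P0" using addx[of h x0] hB x0 by (auto simp: P0_def)
  have "builds ?n {} 0 ({} \<union> order_complex P0)"
  \<comment> \<open>The least element of \<open>P0\<close> is the cone apex. The empty face is
    matched with it, which is why the void complex is the right start.\<close>
  proof (rule builds_collapse[where v = "insert x0 h"])
    fix \<sigma> assume \<sigma>: "\<sigma> \<in> order_complex P0"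
    then show "finite \<sigma>" by (simp add: order_complex_mem_iff)
    have "insert x0 h \<subseteq> F" if "F \<in> P0" for F using that by (auto simp: P0_def transversals_def)
    then show "insert (insert x0 h) \<sigma> \<in> order_complex P0 \<and> \<sigma> - {insert x0 h} \<in> order_complex P0"
      using \<sigma> a by (auto simp: order_complex_mem_iff comparable_def)
  qed (use finP(1) in \<open>auto intro: finite_order_complex order_complex_downward_closed\<close>)
  then have s0: "builds ?n {} 0 (order_complex P0)" by simp
  have s1: "builds ?n (order_complex P0) 0 (order_complex (P0 \<union> P1))"
  proof (rule builds_order_complex_retract[where q = "insert x0" and f = card])
    show "P0 \<inter> P1 = {}" using x0 by (auto simp: P0_def P1_def)
    fix e assume e: "e \<in> P1"
    then show "insert x0 e \<in> P0 \<and> comparable (insert x0 e) e"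
      using addx[of e x0] x0 by (auto simp: P0_def P1_def comparable_def)
    \<comment> \<open>As \<open>x0\<close> is in \<open>r\<close> but not in \<open>e\<close>,
      comparability means that \<open>e\<close> lies in \<open>r\<close>; then so does
      \<open>insert x0 e\<close>.\<close>
    show "comparable r (insert x0 e)" if "r \<in> P0" "comparable r e" for r
      using that e x0 by (auto simp: P0_def P1_def comparable_def)
    show "comparable r (insert x0 e)" if "r \<in> P1" "r \<noteq> e" "card r \<le> card e" "comparable r e" for r
    proof -
      have "finite r" "finite e" using that e finF by (auto simp: P1_def)
      then have "\<not> e \<subseteq> r" using that card_seteq by blast
      then show ?thesis using that by (auto simp: comparable_def)
    qed
  qed (use finP in auto)
  have s2: "builds ?n (order_complex (P0 \<union> P1)) 0 (order_complex (P0 \<union> P1 \<union> P2))"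
  \<comment> \<open>Elements are added by increasing natural-number rank, so subtraction from the
    size of a common superset encodes decreasing cardinality. An earlier comparable \<open>r\<close>
    then contains \<open>e\<close>, and with it \<open>e - B\<close>.\<close>
  proof (rule builds_order_complex_retract[where q = "\<lambda>F. F - B"
        and f = "\<lambda>F. card (h \<union> \<Union>\<X>) - card F"])
    show "(P0 \<union> P1) \<inter> P2 = {}" using one[OF _ _ _ x0] by (auto simp: P0_def P1_def P2_def)
    fix e assume e: "e \<in> P2"
    then obtain x where x: "x \<in> B" "x \<noteq> x0" "x \<in> e" "e \<noteq> insert x h" and eT: "e \<in> ?T"
      by (auto simp: P2_def)
    then have eB: "e \<inter> B = {x}" using one[OF eT] by blast
    \<comment> \<open>The condition \<open>e \<noteq> insert x h\<close> ensures that deleting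
      \<open>x\<close> does not leave just \<open>h\<close>.\<close>
    have "e - B \<in> ?T"
      using eT eB hB x(4) by (auto simp: transversals_def)
    then show "e - B \<in> P0 \<union> P1 \<and> comparable (e - B) e" by (auto simp: P1_def comparable_def)
    \<comment> \<open>An \<open>r\<close> in \<open>P0\<close> meets \<open>B\<close> in
      \<open>x0\<close> instead of \<open>x\<close> and is never comparable to \<open>e\<close>; an
      \<open>r\<close> in \<open>P1\<close> misses \<open>x\<close>, so it must lie inside
      \<open>e\<close> and hence inside \<open>e - B\<close>.\<close>
    show "comparable r (e - B)" if "r \<in> P0 \<union> P1" "comparable r e" for r
      using that(1)
    proof
      assume r: "r \<in> P0"
      then have "r \<inter> B = {x0}" using one[of r] x0 by (auto simp: P0_def)
      then show ?thesis using that(2) eB x by (auto simp: comparable_def)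
    next
      assume "r \<in> P1"
      then show ?thesis using that(2) eB x by (auto simp: comparable_def P1_def)
    qed
    show "comparable r (e - B)" if "r \<in> P2" "r \<noteq> e"
      "card (h \<union> \<Union>\<X>) - card r \<le> card (h \<union> \<Union>\<X>) - card e" "comparable r e" for r
    proof -
      have "r \<subseteq> h \<union> \<Union>\<X>" "e \<subseteq> h \<union> \<Union>\<X>" using that(1) eT by (auto simp: P2_def transversals_def)
      then have "card r \<le> card (h \<union> \<Union>\<X>)" "card e \<le> card (h \<union> \<Union>\<X>)"
        using finU Suc.prems(4) by (auto intro!: card_mono)
      then have "card e \<le> card r" using that(3) by linarith
      moreover have "finite r" "finite e" using that eT finF by (auto simp: P2_def)
      ultimately have "\<not> r \<subset> e" using psubset_card_mono leD by blast
      then show ?thesis using that by (auto simp: comparable_def)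
    qed
  qed (use finP in auto)
  define P where "P Y = P0 \<union> P1 \<union> P2 \<union> (\<lambda>x. insert x h) ` Y" for Y
  define k where "k = (\<Prod>C\<in>\<X> - {B}. card C - 1)"
  have s3: "builds ?n {} (card Y * k) (order_complex (P Y))"
    if "finite Y" "Y \<subseteq> B - {x0}" for Y
    using that
  proof (induction Y rule: finite_induct)
    case empty
    show ?case using builds_trans[OF s2 builds_trans[OF s1 s0]] by (simp add: P_def)
  next
    case (insert x Y)
    have x: "x \<in> B" "x \<noteq> x0" using insert.prems by auto
    have PT: "P Y \<subseteq> ?T"
      using insert.prems addx[of h] hB by (auto simp: P_def P0_def P1_def P2_def)
    have new: "insert x h \<notin> P Y"
    proof -
      have "insert x h \<inter> B = {x}" using hB x by auto
      moreover have "insert x h \<noteq> insert y h" if "y \<in> Y" for y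
      proof -
        have "x \<noteq> y" "x \<notin> h" using that insert.hyps hB x(1) by auto
        then show ?thesis by blast
      qed
      moreover have "insert x h \<notin> P2"
      proof
        assume "insert x h \<in> P2"
        then obtain y where "y \<in> B" "y \<in> insert x h" "insert x h \<noteq> insert y h"
          unfolding P2_def by blast
        then show False using hB by blast
      qed
      moreover have "x0 \<notin> insert x h" using x x0 hB by blast
      ultimately show ?thesis by (auto simp: P_def P0_def P1_def)
    qed
    \<comment> \<open>Nothing lies strictly below a minimal transversal, and all that lies strictly
      above is in \<open>P2\<close>, hence already present.\<close>
    have "{F\<in>P Y. comparable F (insert x h)} = {F\<in>?T. x \<in> F \<and> F \<noteq> insert x h}"
    proof (intro equalityI subsetI)
      fix F assume F: "F \<in> {F\<in>P Y. comparable F (insert x h)}"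
      then have FT: "F \<in> ?T" and "F \<noteq> insert x h" using PT new by auto
      moreover have "\<not> F \<subseteq> insert x h" using FT \<open>F \<noteq> insert x h\<close> by (auto simp: transversals_def)
      ultimately show "F \<in> {F\<in>?T. x \<in> F \<and> F \<noteq> insert x h}" using F by (auto simp: comparable_def)
    next
      fix F assume "F \<in> {F\<in>?T. x \<in> F \<and> F \<noteq> insert x h}"
      then show "F \<in> {F\<in>P Y. comparable F (insert x h)}"
        using x by (auto simp: P_def P2_def comparable_def transversals_def)
    qed
    then have link: "{F\<in>P Y. comparable F (insert x h)} = transversals (insert x h) (\<X> - {B})"
      using transversals_insert_vertex[OF x(1) B Suc.prems(3,5)] by simp
    have card: "card (\<X> - {B}) = m" using Suc.hyps(2) Suc.prems(1) B by simp
    have "builds (int (card (\<X> - {B})) - 1) {} k (order_complex (transversals (insert x h) (\<X> - {B})))"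
      unfolding k_def
    proof (rule Suc.hyps(1))
      show "pairwise disjnt (\<X> - {B})" using Suc.prems(3) by (auto simp: pairwise_def)
      have "x \<notin> C" if "C \<in> \<X>" "C \<noteq> B" for C
        using that x(1) B Suc.prems(3) by (auto simp: pairwise_def disjnt_def)
      then show "insert x h \<inter> \<Union>(\<X> - {B}) = {}" using Suc.prems(5) by auto
    qed (use Suc.prems card in auto)
    \<comment> \<open>One block fewer lowers the dimension of the link by one, and coning over it
      restores \<open>?n\<close>; each new minimal transversal thus contributes \<open>k\<close>
      cells.\<close>
    then have "builds (int (card (\<X> - {B})) - 1 + 1) (order_complex (P Y) \<union> insert (insert x h) ` {}) k
      (order_complex (P Y) \<union> insert (insert x h) ` order_complex (transversals (insert x h) (\<X> - {B})))"
    proof (rule builds_cone)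
      show "insert x h \<notin> \<Union>(order_complex (P Y))" using new by (auto simp: order_complex_mem_iff)
      show "insert x h \<notin> \<Union>(order_complex (transversals (insert x h) (\<X> - {B})))"
        by (auto simp: order_complex_mem_iff transversals_def)
      show "order_complex (transversals (insert x h) (\<X> - {B})) \<subseteq> order_complex (P Y)"
        unfolding link[symmetric] by (auto simp: order_complex_mem_iff)
    qed
    moreover have "int (card (\<X> - {B})) - 1 + 1 = ?n" using card Suc.hyps(2) by simp
    moreover have "order_complex (P Y) \<union> insert (insert x h) ` order_complex (transversals (insert x h) (\<X> - {B}))
      = order_complex (P (insert x Y))"
      using order_complex_insert[OF new] unfolding link by (simp add: P_def)
    ultimately have "builds ?n (order_complex (P Y)) k (order_complex (P (insert x Y)))" by simp
    from builds_trans[OF this insert.IH] insert show ?case by (simp add: add.commute)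
  qed
  have "P (B - {x0}) = ?T"
  proof
    show "P (B - {x0}) \<subseteq> ?T"
      using addx[of h] hB by (auto simp: P_def P0_def P1_def P2_def)
    show "?T \<subseteq> P (B - {x0})"
      by (auto simp: P_def P0_def P1_def P2_def)
  qed
  moreover have "card (B - {x0}) * k = (\<Prod>C\<in>\<X>. card C - 1)"
    using Suc.prems(1,2) B x0 by (simp add: k_def prod.remove[of \<X> B])
  ultimately show ?case using s3[of "B - {x0}"] Suc.prems(2) B by auto
qed

lemma order_complex_antitone_image:
  assumes "\<And>F F'. F \<in> P \<Longrightarrow> F' \<in> P \<Longrightarrow> g F' \<subseteq> g F \<longleftrightarrow> F \<subseteq> F'"
  shows "order_complex (g ` P) = image g ` order_complex P"
proof (intro equalityI subsetI)
  fix \<sigma> assume \<sigma>: "\<sigma> \<in> order_complex (g ` P)"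
  then have "\<sigma> \<subseteq> g ` P" by (simp add: order_complex_def)
  then obtain \<rho> where \<rho>: "\<rho> \<subseteq> P" "\<sigma> = g ` \<rho>" by (meson subset_imageE)
  have "inj_on g \<rho>" using assms \<rho>(1) by (intro inj_onI) (metis subset_antisym subset_refl subsetD)
  then have "finite \<rho>" using \<sigma> \<rho> by (auto simp: order_complex_def dest: finite_imageD)
  moreover have "comparable F F'" if "F \<in> \<rho>" "F' \<in> \<rho>" for F F'
  proof -
    have "comparable (g F) (g F')" using \<sigma> \<rho> that by (auto simp: order_complex_mem_iff)
    then show ?thesis using assms that \<rho>(1) unfolding comparable_def by blast
  qed
  ultimately have "\<rho> \<in> order_complex P" using \<rho> by (simp add: order_complex_mem_iff)
  then show "\<sigma> \<in> image g ` order_complex P" using \<rho> by blast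
next
  fix \<sigma> assume "\<sigma> \<in> image g ` order_complex P"
  then obtain \<rho> where \<rho>: "\<rho> \<in> order_complex P" "\<sigma> = g ` \<rho>" by blast
  have "comparable (g F) (g F')" if "F \<in> \<rho>" "F' \<in> \<rho>" for F F'
  proof -
    have "F \<in> P" "F' \<in> P" "comparable F F'" using \<rho>(1) that by (auto simp: order_complex_mem_iff)
    then show ?thesis using assms unfolding comparable_def by blast
  qed
  then show "\<sigma> \<in> order_complex (g ` P)" using \<rho> by (auto simp: order_complex_mem_iff)
qed

subsection \<open>The interval and its cosets\<close>

lemma sum_alternating_Pow:
  assumes "finite A" and "A \<noteq> {}"
  shows "(\<Sum>T\<in>Pow A. (-1) ^ card T) = (0::int)"
  using prod_add[OF assms(1), of "\<lambda>_. -1" "\<lambda>_. 1::int"] assms by (simp add: power_0_left)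

text \<open>The recursion sums the signs over all proper subsets of \<open>f x\<close>. Over all
  subsets of a nonempty set they cancel, so the missing top term appears with opposite sign.\<close>

lemma mobius_boolean:
  fixes P :: "'b::order set" and f :: "'b \<Rightarrow> 'c set"
  assumes fin: "finite A" and bij: "bij_betw f P (Pow A)"
    and ord: "\<And>x y. x \<in> P \<Longrightarrow> y \<in> P \<Longrightarrow> x \<le> y \<longleftrightarrow> f x \<subseteq> f y"
    and b: "b \<in> P" "f b = {}" and x: "x \<in> P"
  shows "mobius P b x = (-1) ^ card (f x)"
  using x
proof (induction "card (f x)" arbitrary: x rule: less_induct)
  case less
  have finP: "finite P" using bij fin bij_betw_finite by blast
  have inj: "inj_on f P" using bij by (simp add: bij_betw_def)
  have fx: "f x \<subseteq> A" "finite (f x)"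
    using less.prems bij fin by (auto simp: bij_betw_def intro: finite_subset)
  have lt: "z < y \<longleftrightarrow> f z \<subset> f y" if "z \<in> P" "y \<in> P" for z y
    using ord that by (auto simp: less_le_not_le)
  have bx: "b \<le> x" using ord b less.prems by simp
  show ?case
  proof (cases "b = x")
    case True
    then show ?thesis using finP b by (subst mobius.simps) simp
  next
    case False
    then have ne: "f x \<noteq> {}" using inj b less.prems by (auto simp: inj_on_def)
    let ?Z = "{z\<in>P. b \<le> z \<and> z < x}"
    have "mobius P b x = - (\<Sum>z\<in>?Z. mobius P b z)"
      using finP b bx less.prems False by (subst mobius.simps) simp
    also have "(\<Sum>z\<in>?Z. mobius P b z) = (\<Sum>z\<in>?Z. (-1) ^ card (f z))"
    proof (rule sum.cong[OF refl])
      fix z assume z: "z \<in> ?Z"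
      then have "f z \<subset> f x" using lt less.prems by blast
      then show "mobius P b z = (-1) ^ card (f z)"
        using z fx(2) by (intro less.hyps psubset_card_mono) auto
    qed
    also have "\<dots> = (\<Sum>T\<in>f ` ?Z. (-1) ^ card T)"
      using inj by (intro sum.reindex_cong[symmetric, OF _ refl refl]) (auto intro: inj_on_subset)
    also have "f ` ?Z = Pow (f x) - {f x}"
    proof (intro equalityI subsetI)
      fix T assume T: "T \<in> Pow (f x) - {f x}"
      then have "T \<in> f ` P" using fx(1) bij by (auto simp: bij_betw_def)
      then obtain z where "z \<in> P" "T = f z" by blast
      then have "z \<in> ?Z" using T lt ord b less.prems by auto
      then show "T \<in> f ` ?Z" using \<open>T = f z\<close> by blast
    qed (use lt less.prems in auto)
    also have "(\<Sum>T\<in>Pow (f x) - {f x}. (-1) ^ card T) = - ((-1) ^ card (f x) :: int)"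
      using sum_alternating_Pow[OF fx(2) ne] sum.remove[of "Pow (f x)" "f x" "\<lambda>T. (-1) ^ card T :: int"] fx(2)
      by simp
    finally show ?thesis by simp
  qed
qed

section \<open>The interval described by its coatoms\<close>

locale group_complemented_boolean_interval = group G for G (structure) +
  fixes H :: "'a set" and m :: nat and f :: "'a set \<Rightarrow> nat set"
  assumes finite_carrier: "finite (carrier G)" and subgroup_H: "subgroup H G"
    and bij_f: "bij_betw f (subgroup_interval G H) (Pow {..<m})"
    and f_mono_iff: "\<And>K L. K \<in> subgroup_interval G H \<Longrightarrow> L \<in> subgroup_interval G H \<Longrightarrow>
      K \<subseteq> L \<longleftrightarrow> f K \<subseteq> f L"
    and complemented: "group_complemented G H"
begin

text \<open>The intersection of the maximal subgroups with indices in \<open>S\<close>; in particular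
  \<open>coatom_meet {i}\<close> are the coatoms.\<close>

definition coatom_meet :: "nat set \<Rightarrow> 'a set"
  where "coatom_meet S = inv_into (subgroup_interval G H) f ({..<m} - S)"

lemma meet_in_interval: "coatom_meet S \<in> subgroup_interval G H"
  unfolding coatom_meet_def using bij_f by (intro inv_into_into) (auto simp: bij_betw_def)

lemma subgroup_meet: "subgroup (coatom_meet S) G" and H_subset_meet: "H \<subseteq> coatom_meet S"
  using meet_in_interval by (auto simp: subgroup_interval_def)

lemma meet_subset_carrier: "coatom_meet S \<subseteq> carrier G"
  by (rule subgroup.subset[OF subgroup_meet])

lemma f_meet: "f (coatom_meet S) = {..<m} - S"
  unfolding coatom_meet_def using bij_f by (intro f_inv_into_f) (auto simp: bij_betw_def)

lemma f_subset: "K \<in> subgroup_interval G H \<Longrightarrow> f K \<subseteq> {..<m}"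
  using bij_f by (auto simp: bij_betw_def)

lemma meet_f: "K \<in> subgroup_interval G H \<Longrightarrow> coatom_meet ({..<m} - f K) = K"
  unfolding coatom_meet_def using bij_f f_subset
  by (simp add: double_diff bij_betw_def)

lemma interval_cases:
  assumes "K \<in> subgroup_interval G H"
  obtains S where "S \<subseteq> {..<m}" and "K = coatom_meet S"
  using meet_f[OF assms] that[of "{..<m} - f K"] by auto

lemma meet_subset_iff: "S \<subseteq> {..<m} \<Longrightarrow> T \<subseteq> {..<m} \<Longrightarrow> coatom_meet S \<subseteq> coatom_meet T \<longleftrightarrow> T \<subseteq> S"
  using f_mono_iff[OF meet_in_interval meet_in_interval, of S T] by (auto simp: f_meet)

lemma meet_eq_iff: "S \<subseteq> {..<m} \<Longrightarrow> T \<subseteq> {..<m} \<Longrightarrow> coatom_meet S = coatom_meet T \<longleftrightarrow> S = T"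
  using meet_subset_iff by (metis subset_antisym subset_refl)

lemma meet_empty: "coatom_meet {} = carrier G"
proof -
  have "carrier G \<in> subgroup_interval G H"
    using subgroup_self subgroup.subset[OF subgroup_H] by (simp add: subgroup_interval_def)
  then obtain S where S: "S \<subseteq> {..<m}" "carrier G = coatom_meet S" by (rule interval_cases)
  then have "coatom_meet S \<subseteq> coatom_meet {}" using meet_subset_iff[of S "{}"] by simp
  then show ?thesis using S(2) meet_subset_carrier by blast
qed

lemma meet_all: "coatom_meet {..<m} = H"
proof -
  have "H \<in> subgroup_interval G H"
    using subgroup_H by (simp add: subgroup_interval_def)
  then obtain S where S: "S \<subseteq> {..<m}" "H = coatom_meet S" by (rule interval_cases)
  then have "coatom_meet {..<m} \<subseteq> H" using meet_subset_iff[of "{..<m}" S] by simp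
  then show ?thesis using H_subset_meet by blast
qed

text \<open>The intersection is itself a member \<open>coatom_meet U\<close> of the interval; the
  order isomorphism forces \<open>U\<close> to contain \<open>S\<close> and
  \<open>T\<close>.\<close>

lemma meet_Un:
  assumes "S \<subseteq> {..<m}" and "T \<subseteq> {..<m}"
  shows "coatom_meet (S \<union> T) = coatom_meet S \<inter> coatom_meet T"
proof
  show "coatom_meet (S \<union> T) \<subseteq> coatom_meet S \<inter> coatom_meet T" using assms meet_subset_iff by simp
  have "coatom_meet S \<inter> coatom_meet T \<in> subgroup_interval G H"
    using subgroups_Inter_pair[OF subgroup_meet subgroup_meet] H_subset_meet
    by (simp add: subgroup_interval_def)
  then obtain U where U: "U \<subseteq> {..<m}" "coatom_meet S \<inter> coatom_meet T = coatom_meet U" by (rule interval_cases)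
  then have "coatom_meet U \<subseteq> coatom_meet S" "coatom_meet U \<subseteq> coatom_meet T" by auto
  then have "S \<union> T \<subseteq> U" using U(1) assms meet_subset_iff by auto
  then show "coatom_meet S \<inter> coatom_meet T \<subseteq> coatom_meet (S \<union> T)" using U assms meet_subset_iff[of U "S \<union> T"] by simp
qed

lemma mem_meet_iff:
  assumes "S \<subseteq> {..<m}"
  shows "x \<in> coatom_meet S \<longleftrightarrow> x \<in> carrier G \<and> (\<forall>i\<in>S. x \<in> coatom_meet {i})"
proof -
  have "finite S" using assms finite_subset by blast
  then show ?thesis using assms
  proof (induction S rule: finite_induct)
    case empty
    then show ?case by (simp add: meet_empty)
  next
    case (insert i S)
    have "coatom_meet (insert i S) = coatom_meet {i} \<inter> coatom_meet S"
      using meet_Un[of "{i}" S] insert.prems by simp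
    then show ?case using insert by auto
  qed
qed

lemma generate_in_interval:
  assumes "A \<subseteq> carrier G" and "H \<subseteq> generate G A"
  shows "generate G A \<in> subgroup_interval G H"
  using assms generate_is_subgroup by (simp add: subgroup_interval_def)

text \<open>For a candidate \<open>coatom_meet T\<close>, intersecting in \<open>H\<close> says that
  \<open>insert i T\<close> is everything, and generating \<open>G\<close> excludes \<open>i\<close>
  from \<open>T\<close>. This settles uniqueness, which the definite description requires.\<close>

lemma lattice_complement_coatom:
  assumes i: "i < m"
  shows "lattice_complement G H (coatom_meet {i}) = coatom_meet ({..<m} - {i})"
  unfolding lattice_complement_def
proof (rule the_equality, intro conjI)
  let ?L = "coatom_meet ({..<m} - {i})"
  let ?J = "generate G (coatom_meet {i} \<union> ?L)"
  show "?L \<in> subgroup_interval G H" by (rule meet_in_interval)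
  show "coatom_meet {i} \<inter> ?L = H"
    using meet_Un[of "{i}" "{..<m} - {i}"] i meet_all by (simp add: insert_absorb)
  have sub: "coatom_meet {i} \<union> ?L \<subseteq> ?J" by (rule subsetI) (rule generate.incl)
  have "?J \<in> subgroup_interval G H"
    using sub H_subset_meet meet_subset_carrier by (intro generate_in_interval) blast+
  then obtain T where T: "T \<subseteq> {..<m}" "?J = coatom_meet T" by (rule interval_cases)
  then have "T \<subseteq> {i}" "T \<subseteq> {..<m} - {i}"
    using sub i meet_subset_iff[of "{i}" T] meet_subset_iff[of "{..<m} - {i}" T] by auto
  then have "T = {}" by blast
  then show "?J = carrier G" using T meet_empty by simp
next
  fix L assume L: "L \<in> subgroup_interval G H \<and> coatom_meet {i} \<inter> L = H \<and>
    generate G (coatom_meet {i} \<union> L) = carrier G"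
  then obtain T where T: "T \<subseteq> {..<m}" "L = coatom_meet T" by (auto elim: interval_cases)
  have "coatom_meet (insert i T) = coatom_meet {..<m}"
    using meet_Un[of "{i}" T] T i L meet_all by simp
  then have "insert i T = {..<m}" using meet_eq_iff[of "insert i T" "{..<m}"] T i by simp
  moreover have "i \<notin> T"
  proof
    assume "i \<in> T"
    then have "coatom_meet {i} \<union> L = coatom_meet {i}" using T i meet_subset_iff[of T "{i}"] by auto
    then have "coatom_meet {} \<subseteq> coatom_meet {i}"
      using L meet_empty generate_subgroup_incl[OF subset_refl subgroup_meet, of "{i}"] by simp
    then show False using meet_subset_iff[of "{}" "{i}"] i by simp
  qed
  ultimately have "T = {..<m} - {i}" by blast
  then show "L = coatom_meet ({..<m} - {i})" using T by simp
qed

text \<open>Group-complementedness at the coatom \<open>i\<close> gives the case of all the other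
  indices; the meet over the smaller set \<open>S\<close> is a larger subgroup, so the product can
  only grow.\<close>

lemma coatom_mult:
  assumes "i < m" and "S \<subseteq> {..<m}" and "i \<notin> S"
  shows "coatom_meet {i} <#> coatom_meet S = carrier G"
proof
  show "coatom_meet {i} <#> coatom_meet S \<subseteq> carrier G" by (intro set_mult_closed meet_subset_carrier)
  have "carrier G = coatom_meet {i} <#> coatom_meet ({..<m} - {i})"
    using bspec[OF complemented[unfolded group_complemented_def] meet_in_interval[of "{i}"]]
    by (simp add: lattice_complement_coatom[OF assms(1)])
  also have "\<dots> \<subseteq> coatom_meet {i} <#> coatom_meet S"
    using assms by (intro mono_set_mult subset_refl) (simp add: meet_subset_iff subset_Diff_insert)
  finally show "carrier G \<subseteq> coatom_meet {i} <#> coatom_meet S" .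
qed

section \<open>A Chinese remainder theorem for right cosets\<close>

definition coset_choices :: "nat set \<Rightarrow> (nat \<Rightarrow> 'a set) set"
  where "coset_choices S = (\<Pi>\<^sub>E i\<in>S. rcosets (coatom_meet {i}))"

text \<open>Membership in the carrier makes the empty choice yield the whole group, where a bare
  intersection would be the universe of the type.\<close>

definition coset_meet :: "nat set \<Rightarrow> (nat \<Rightarrow> 'a set) \<Rightarrow> 'a set"
  where "coset_meet S \<phi> = {x \<in> carrier G. \<forall>i\<in>S. x \<in> \<phi> i}"

lemma rcos_unique:
  assumes "subgroup K G" and "C \<in> rcosets K" and "x \<in> C"
  shows "C = K #> x" and "x \<in> carrier G"
  using assms repr_independence subgroup.rcosets_carrier[OF assms(1) is_group assms(2)]
  by (auto simp: RCOSETS_def)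

lemma mem_rcos_iff:
  "subgroup K G \<Longrightarrow> x \<in> carrier G \<Longrightarrow> y \<in> K #> x \<longleftrightarrow> y \<in> carrier G \<and> y \<otimes> inv x \<in> K"
  using subgroup.rcos_module[OF _ is_group] subgroup.elemrcos_carrier[OF _ is_group] by blast

lemma meet_rcos_iff:
  assumes "S \<subseteq> {..<m}" and "g \<in> carrier G"
  shows "y \<in> coatom_meet S #> g \<longleftrightarrow> y \<in> carrier G \<and> (\<forall>i\<in>S. y \<in> coatom_meet {i} #> g)"
  using assms mem_meet_iff[OF assms(1)] by (auto simp: mem_rcos_iff[OF subgroup_meet])

lemma coset_meet_eq:
  assumes S: "S \<subseteq> {..<m}" and \<phi>: "\<And>i. i \<in> S \<Longrightarrow> \<phi> i \<in> rcosets (coatom_meet {i})"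
    and g: "g \<in> coset_meet S \<phi>"
  shows "coset_meet S \<phi> = coatom_meet S #> g"
proof -
  have "\<phi> i = coatom_meet {i} #> g" if "i \<in> S" for i
    using rcos_unique(1)[OF subgroup_meet \<phi>[OF that]] g that by (simp add: coset_meet_def)
  moreover have "g \<in> carrier G" using g by (simp add: coset_meet_def)
  ultimately show ?thesis
    using meet_rcos_iff[OF S] by (auto simp: coset_meet_def)
qed

text \<open>The analogue of the Chinese remainder theorem: in the induction step, a factorization
  \<open>g' g\<^sup>-\<^sup>1 = k l\<close> with \<open>k\<close> in the new coatom and \<open>l\<close> in the meet of the old ones yields the
  common element \<open>k\<^sup>-\<^sup>1 g' = l g\<close>.\<close>

lemma coset_meet_nonempty:
  assumes "S \<subseteq> {..<m}" and "\<And>i. i \<in> S \<Longrightarrow> \<phi> i \<in> rcosets (coatom_meet {i})"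
  shows "coset_meet S \<phi> \<noteq> {}"
proof -
  have "finite S" using assms(1) finite_subset by blast
  then show ?thesis using assms
  proof (induction S rule: finite_induct)
    case empty
    then show ?case by (auto simp: coset_meet_def)
  next
    case (insert i S)
    then obtain g where g: "g \<in> coset_meet S \<phi>" by auto
    then have gG: "g \<in> carrier G" by (simp add: coset_meet_def)
    have "\<phi> i \<in> rcosets (coatom_meet {i})" using insert.prems by simp
    then obtain g' where g': "g' \<in> carrier G" "\<phi> i = coatom_meet {i} #> g'"
      unfolding RCOSETS_def by blast
    have "g' \<otimes> inv g \<in> coatom_meet {i} <#> coatom_meet S"
      using coatom_mult[of i S] insert gG g' by auto
    then obtain k l where kl: "k \<in> coatom_meet {i}" "l \<in> coatom_meet S" "g' \<otimes> inv g = k \<otimes> l"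
      by (auto simp: set_mult_def)
    have klG: "k \<in> carrier G" "l \<in> carrier G" using kl meet_subset_carrier by auto
    have "g' = k \<otimes> l \<otimes> g" using kl(3) gG g' klG by (metis inv_solve_right' m_closed)
    then have y: "inv k \<otimes> g' = l \<otimes> g" using klG gG by (simp add: m_assoc inv_solve_left')
    have "l \<otimes> g \<in> coset_meet S \<phi>"
      using coset_meet_eq[OF _ _ g] insert.prems kl(2) gG meet_subset_carrier rcosI by auto
    moreover have "inv k \<otimes> g' \<in> \<phi> i"
      unfolding g'(2) using kl(1) g' meet_subset_carrier subgroup.m_inv_closed[OF subgroup_meet] rcosI
      by auto
    ultimately have "l \<otimes> g \<in> coset_meet (insert i S) \<phi>" using y by (simp add: coset_meet_def)
    then show ?case by blast
  qed
qed

text \<open>A common element determines the coset of each coatom; since the meet is nonempty, it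
  determines the whole choice.\<close>

lemma bij_coset_meet:
  assumes S: "S \<subseteq> {..<m}"
  shows "bij_betw (coset_meet S) (coset_choices S) (rcosets (coatom_meet S))"
proof (rule bij_betwI')
  fix \<phi> \<psi> assume \<phi>: "\<phi> \<in> coset_choices S" and \<psi>: "\<psi> \<in> coset_choices S"
  show "coset_meet S \<phi> = coset_meet S \<psi> \<longleftrightarrow> \<phi> = \<psi>"
  proof
    assume eq: "coset_meet S \<phi> = coset_meet S \<psi>"
    have "coset_meet S \<phi> \<noteq> {}" using \<phi> by (intro coset_meet_nonempty S) (auto simp: coset_choices_def)
    then obtain g where g: "g \<in> coset_meet S \<phi>" "g \<in> coset_meet S \<psi>" using eq by blast
    show "\<phi> = \<psi>"
    proof (rule PiE_ext[OF \<phi>[unfolded coset_choices_def] \<psi>[unfolded coset_choices_def]])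
      fix i assume "i \<in> S"
      then show "\<phi> i = \<psi> i"
        using rcos_unique(1)[OF subgroup_meet, of "\<phi> i" "{i}" g]
          rcos_unique(1)[OF subgroup_meet, of "\<psi> i" "{i}" g] \<phi> \<psi> g
        by (simp add: coset_choices_def coset_meet_def PiE_iff)
    qed
  qed simp
next
  fix \<phi> assume \<phi>: "\<phi> \<in> coset_choices S"
  then have in_rc: "\<phi> i \<in> rcosets (coatom_meet {i})" if "i \<in> S" for i
    using that by (auto simp: coset_choices_def)
  obtain g where g: "g \<in> coset_meet S \<phi>" using coset_meet_nonempty[OF S, of \<phi>] in_rc by blast
  then have "g \<in> carrier G" by (simp add: coset_meet_def)
  then show "coset_meet S \<phi> \<in> rcosets (coatom_meet S)"
    using coset_meet_eq[OF S in_rc g] rcosetsI[OF meet_subset_carrier] by simp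
next
  fix C assume "C \<in> rcosets (coatom_meet S)"
  then obtain g where g: "g \<in> carrier G" "C = coatom_meet S #> g" by (auto simp: RCOSETS_def)
  let ?\<phi> = "\<lambda>i\<in>S. coatom_meet {i} #> g"
  have "?\<phi> \<in> coset_choices S"
    using rcosetsI[OF meet_subset_carrier g(1)] by (auto simp: coset_choices_def)
  moreover have "C = coset_meet S ?\<phi>"
    using g meet_rcos_iff[OF S g(1)] by (auto simp: coset_meet_def)
  ultimately show "\<exists>\<phi>\<in>coset_choices S. C = coset_meet S \<phi>" by blast
qed

section \<open>The totient and the number of generating cosets as products\<close>

definition ind :: "nat \<Rightarrow> nat"
  where "ind i = card (rcosets (coatom_meet {i}))"

lemma finite_rcosets: "finite (rcosets K)"
  using finite_carrier by (auto simp: RCOSETS_def)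

lemma card_rcosets_meet: "S \<subseteq> {..<m} \<Longrightarrow> card (rcosets (coatom_meet S)) = (\<Prod>i\<in>S. ind i)"
  using bij_betw_same_card[OF bij_coset_meet, of S] card_PiE[of S "\<lambda>i. rcosets (coatom_meet {i})"]
  by (simp add: coset_choices_def ind_def finite_subset[of S "{..<m}"])

lemma coatom_in_rcosets: "coatom_meet {i} \<in> rcosets (coatom_meet {i})"
  using rcosetsI[OF meet_subset_carrier one_closed] coset_mult_one[OF meet_subset_carrier] by metis

text \<open>Makes the factors \<open>ind i - 1\<close> positive, and keeps their natural subtraction
  from truncating.\<close>

lemma ind_ge_2:
  assumes "i < m"
  shows "ind i \<ge> 2"
proof -
  have "coatom_meet {i} \<noteq> carrier G" using meet_eq_iff[of "{i}" "{}"] assms meet_empty by simp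
  then obtain g where g: "g \<in> carrier G" "g \<notin> coatom_meet {i}" using meet_subset_carrier by blast
  then have "coatom_meet {i} #> g \<noteq> coatom_meet {i}" using rcos_self[OF g(1) subgroup_meet] by blast
  moreover have "coatom_meet {i} #> g \<in> rcosets (coatom_meet {i})" by (rule rcosetsI[OF meet_subset_carrier g(1)])
  ultimately have "card {coatom_meet {i}, coatom_meet {i} #> g} \<le> ind i"
    unfolding ind_def using coatom_in_rcosets by (intro card_mono finite_rcosets) auto
  then show ?thesis using \<open>coatom_meet {i} #> g \<noteq> coatom_meet {i}\<close> by simp
qed

text \<open>The summand for \<open>coatom_meet S\<close> is the product of \<open>ind i\<close> over
  \<open>S\<close> times one factor \<open>-1\<close> for each index outside \<open>S\<close>: the
  expansion of the product of the \<open>ind i + - 1\<close>.\<close>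

lemma dual_totient_eq: "dual_totient G H = (\<Prod>i<m. int (ind i) - 1)"
proof -
  have bij: "bij_betw coatom_meet (Pow {..<m}) (subgroup_interval G H)"
  proof (rule bij_betwI')
    show "coatom_meet S = coatom_meet T \<longleftrightarrow> S = T" if "S \<in> Pow {..<m}" "T \<in> Pow {..<m}" for S T
      using that meet_eq_iff by simp
    show "coatom_meet S \<in> subgroup_interval G H" for S by (rule meet_in_interval)
    show "\<exists>S\<in>Pow {..<m}. K = coatom_meet S" if "K \<in> subgroup_interval G H" for K
      using that by (auto elim: interval_cases)
  qed
  have mob: "mobius (subgroup_interval G H) H (coatom_meet S) = (-1) ^ card ({..<m} - S)" for S
  proof -
    have "H \<in> subgroup_interval G H" "f H = {}"
      using meet_in_interval[of "{..<m}"] f_meet[of "{..<m}"] meet_all by auto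
    from mobius_boolean[OF _ bij_f f_mono_iff this meet_in_interval[of S]] show ?thesis
      by (simp add: f_meet)
  qed
  have "dual_totient G H = (\<Sum>S\<in>Pow {..<m}. (-1) ^ card ({..<m} - S) * int (card (rcosets (coatom_meet S))))"
    unfolding dual_totient_def sum.reindex_bij_betw[OF bij, symmetric] mob ..
  also have "\<dots> = (\<Sum>S\<in>Pow {..<m}. (\<Prod>i\<in>S. int (ind i)) * (\<Prod>i\<in>{..<m} - S. -1))"
    by (intro sum.cong refl) (auto simp: card_rcosets_meet)
  also have "\<dots> = (\<Prod>i<m. int (ind i) + - 1)" by (rule prod_add[symmetric]) simp
  finally show ?thesis by simp
qed

text \<open>The generated subgroup contains \<open>g\<close>, hence also
  \<open>h = (h \<otimes> g) \<otimes> inv g\<close> for \<open>h\<close> in \<open>H\<close>. So it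
  is a member of the interval, and a proper member lies in some coatom.\<close>

lemma generate_coset_eq_carrier_iff:
  assumes g: "g \<in> carrier G"
  shows "generate G (H #> g) = carrier G \<longleftrightarrow> (\<forall>i<m. g \<notin> coatom_meet {i})"
proof
  assume gen: "generate G (H #> g) = carrier G"
  show "\<forall>i<m. g \<notin> coatom_meet {i}"
  proof (intro allI impI notI)
    fix i assume i: "i < m" "g \<in> coatom_meet {i}"
    then have "H #> g \<subseteq> coatom_meet {i}"
      using H_subset_meet[of "{i}"] subgroup.m_closed[OF subgroup_meet] by (auto simp: r_coset_def)
    then have "generate G (H #> g) \<subseteq> coatom_meet {i}" by (rule generate_subgroup_incl[OF _ subgroup_meet])
    then have "coatom_meet {} \<subseteq> coatom_meet {i}" using gen meet_empty by simp
    then show False using meet_subset_iff[of "{}" "{i}"] i(1) by simp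
  qed
next
  assume R: "\<forall>i<m. g \<notin> coatom_meet {i}"
  let ?J = "generate G (H #> g)"
  have HG: "H \<subseteq> carrier G" by (rule subgroup.subset[OF subgroup_H])
  have sub: "H #> g \<subseteq> ?J" by (auto intro: generate.incl)
  have sJ: "subgroup ?J G" using r_coset_subset_G[OF HG g] by (rule generate_is_subgroup)
  have gJ: "g \<in> ?J" using sub rcos_self[OF g subgroup_H] by blast
  have "H \<subseteq> ?J"
  proof
    fix h assume h: "h \<in> H"
    then have "h \<otimes> g \<in> ?J" using sub rcosI[OF _ HG g] by blast
    then have "h \<otimes> g \<otimes> inv g \<in> ?J"
      by (rule subgroup.m_closed[OF sJ _ subgroup.m_inv_closed[OF sJ gJ]])
    moreover have "h \<otimes> g \<otimes> inv g = h" using h HG g by (auto simp: m_assoc)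
    ultimately show "h \<in> ?J" by simp
  qed
  then have "?J \<in> subgroup_interval G H" using sJ by (simp add: subgroup_interval_def)
  then obtain S where S: "S \<subseteq> {..<m}" "?J = coatom_meet S" by (rule interval_cases)
  have "i \<notin> S" for i
    using R S gJ mem_meet_iff[OF S(1), of g] by auto
  then have "S = {}" by blast
  then show "?J = carrier G" using S meet_empty by simp
qed

text \<open>A coset of \<open>H\<close> is a choice of one coset per coatom; it generates
  \<open>G\<close> exactly if no chosen coset is the coatom itself, which leaves
  \<open>ind i - 1\<close> options for each \<open>i\<close>.\<close>

lemma card_generating_cosets:
  "card {H #> g | g. g \<in> carrier G \<and> generate G (H #> g) = carrier G} = (\<Prod>i<m. ind i - 1)"
proof -
  let ?X = "\<Pi>\<^sub>E i\<in>{..<m}. rcosets (coatom_meet {i}) - {coatom_meet {i}}"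
  have sub: "?X \<subseteq> coset_choices {..<m}"
    unfolding coset_choices_def by (intro PiE_mono) auto
  have bij: "bij_betw (coset_meet {..<m}) (coset_choices {..<m}) (rcosets H)"
    using bij_coset_meet[of "{..<m}"] meet_all by simp
  have key: "generate G (H #> g) = carrier G \<longleftrightarrow> \<phi> \<in> ?X"
    if \<phi>: "\<phi> \<in> coset_choices {..<m}" and g: "g \<in> coset_meet {..<m} \<phi>" for \<phi> g
  proof -
    have gG: "g \<in> carrier G" using g by (simp add: coset_meet_def)
    have "\<phi> i = coatom_meet {i} \<longleftrightarrow> g \<in> coatom_meet {i}" if "i < m" for i
    proof -
      have "\<phi> i \<in> rcosets (coatom_meet {i})" "g \<in> \<phi> i"
        using \<phi> g that by (auto simp: coset_choices_def coset_meet_def)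
      then show ?thesis
        using rcos_unique(1)[OF subgroup_meet] coatom_in_rcosets by metis
    qed
    then show ?thesis using \<phi> generate_coset_eq_carrier_iff[OF gG]
      by (auto simp: coset_choices_def PiE_iff)
  qed
  have "{H #> g | g. g \<in> carrier G \<and> generate G (H #> g) = carrier G} = coset_meet {..<m} ` ?X"
  proof (intro equalityI subsetI)
    fix C assume "C \<in> {H #> g | g. g \<in> carrier G \<and> generate G (H #> g) = carrier G}"
    then obtain g where g: "C = H #> g" "g \<in> carrier G" "generate G (H #> g) = carrier G" by blast
    then have "C \<in> rcosets H" using rcosetsI[OF subgroup.subset[OF subgroup_H]] by simp
    then obtain \<phi> where \<phi>: "\<phi> \<in> coset_choices {..<m}" "C = coset_meet {..<m} \<phi>"
      using bij by (auto simp: bij_betw_def)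
    moreover have "g \<in> C" using g rcos_self[OF _ subgroup_H] by simp
    ultimately show "C \<in> coset_meet {..<m} ` ?X" using key g(3) by blast
  next
    fix C assume "C \<in> coset_meet {..<m} ` ?X"
    then obtain \<phi> where \<phi>: "\<phi> \<in> ?X" "C = coset_meet {..<m} \<phi>" by blast
    then have \<phi>': "\<phi> \<in> coset_choices {..<m}" using sub by blast
    then have "C \<in> rcosets H" using bij \<phi> by (auto simp: bij_betw_def)
    then obtain g where g: "g \<in> carrier G" "C = H #> g" by (auto simp: RCOSETS_def)
    then have "g \<in> coset_meet {..<m} \<phi>" using \<phi>(2) rcos_self[OF _ subgroup_H] by simp
    then show "C \<in> {H #> g | g. g \<in> carrier G \<and> generate G (H #> g) = carrier G}"
      using key[OF \<phi>'] \<phi>(1) g by blast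
  qed
  moreover have "inj_on (coset_meet {..<m}) ?X"
    using bij sub by (auto simp: bij_betw_def intro: inj_on_subset)
  ultimately show ?thesis
    by (simp add: card_image card_PiE ind_def card_Diff_singleton[OF coatom_in_rcosets])
qed

section \<open>The coset poset as the dual of a poset of transversals\<close>

definition coatom_cosets :: "'a set set set"
  where "coatom_cosets = (\<lambda>i. rcosets (coatom_meet {i})) ` {..<m}"

text \<open>A coset determines its subgroup: translating \<open>C\<close> back by one of its
  elements recovers the coatom. Hence the blocks can consist of the cosets themselves, without index
  tags.\<close>

lemma rcosets_coatom_disjoint:
  assumes "C \<in> rcosets (coatom_meet {i})" and "C \<in> rcosets (coatom_meet {j})" and "i < m" and "j < m"
  shows "i = j"
proof -
  obtain g where g: "g \<in> carrier G" "C = coatom_meet {i} #> g" using assms(1) by (auto simp: RCOSETS_def)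
  then have "g \<in> C" using rcos_self[OF _ subgroup_meet] by simp
  then have eq: "coatom_meet {i} #> g = coatom_meet {j} #> g" using rcos_unique(1)[OF subgroup_meet assms(2)] g by simp
  have "x \<in> coatom_meet {k} \<longleftrightarrow> x \<in> carrier G \<and> x \<otimes> g \<in> coatom_meet {k} #> g" for x k
    using mem_rcos_iff[OF subgroup_meet g(1), of "x \<otimes> g" "{k}"] g(1) meet_subset_carrier[of "{k}"]
    by (auto simp: m_assoc)
  then have "coatom_meet {i} = coatom_meet {j}" using eq by auto
  then show ?thesis using meet_eq_iff[of "{i}" "{j}"] assms by simp
qed

lemma inj_coatom_cosets: "inj_on (\<lambda>i. rcosets (coatom_meet {i})) {..<m}"
  using rcosets_coatom_disjoint coatom_in_rcosets by (intro inj_onI) (metis lessThan_iff)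

lemma disjoint_coatom_cosets: "pairwise disjnt coatom_cosets"
  unfolding coatom_cosets_def pairwise_def disjnt_def using rcosets_coatom_disjoint by blast

text \<open>By the Chinese remainder theorem the cosets in a transversal share an element
  \<open>g\<close>, so each of them is the translate of its coatom by that \<open>g\<close>.\<close>

lemma transversals_coatom_cosets:
  "transversals {} coatom_cosets =
    {(\<lambda>i. coatom_meet {i} #> g) ` S | g S. g \<in> carrier G \<and> S \<subseteq> {..<m} \<and> S \<noteq> {}}"
proof (intro equalityI subsetI)
  fix F assume F: "F \<in> transversals {} coatom_cosets"
  have FU: "F \<subseteq> (\<Union>i<m. rcosets (coatom_meet {i}))" and ne: "F \<noteq> {}"
    using F by (auto simp: transversals_def coatom_cosets_def)
  have one: "C = D" if "C \<in> F" "D \<in> F" "C \<in> rcosets (coatom_meet {i})" "D \<in> rcosets (coatom_meet {i})" "i < m" for C D i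
    using F that by (auto simp: transversals_def coatom_cosets_def)
  define S where "S = {i. i < m \<and> F \<inter> rcosets (coatom_meet {i}) \<noteq> {}}"
  have S: "S \<subseteq> {..<m}" by (auto simp: S_def)
  have "\<forall>i\<in>S. \<exists>C. C \<in> F \<and> C \<in> rcosets (coatom_meet {i})" by (auto simp: S_def)
  then obtain \<phi> where \<phi>: "\<And>i. i \<in> S \<Longrightarrow> \<phi> i \<in> F" "\<And>i. i \<in> S \<Longrightarrow> \<phi> i \<in> rcosets (coatom_meet {i})"
    by metis
  have F_eq: "F = \<phi> ` S"
  proof
    show "F \<subseteq> \<phi> ` S"
    proof
      fix C assume C: "C \<in> F"
      then obtain i where i: "i < m" "C \<in> rcosets (coatom_meet {i})" using FU by blast
      then have "i \<in> S" using C by (auto simp: S_def)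
      then show "C \<in> \<phi> ` S" using one[OF C \<phi>(1) i(2) \<phi>(2) i(1)] by blast
    qed
  qed (use \<phi> in auto)
  obtain g where g: "g \<in> coset_meet S \<phi>" using coset_meet_nonempty[OF S \<phi>(2)] by blast
  have "\<phi> i = coatom_meet {i} #> g" if "i \<in> S" for i
    using rcos_unique(1)[OF subgroup_meet \<phi>(2)[OF that]] g that by (simp add: coset_meet_def)
  then have "F = (\<lambda>i. coatom_meet {i} #> g) ` S" using F_eq by auto
  moreover have "g \<in> carrier G" using g by (simp add: coset_meet_def)
  moreover have "S \<noteq> {}" using ne F_eq by auto
  ultimately show "F \<in> {(\<lambda>i. coatom_meet {i} #> g) ` S | g S. g \<in> carrier G \<and> S \<subseteq> {..<m} \<and> S \<noteq> {}}"
    using S by blast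
next
  fix F assume "F \<in> {(\<lambda>i. coatom_meet {i} #> g) ` S | g S. g \<in> carrier G \<and> S \<subseteq> {..<m} \<and> S \<noteq> {}}"
  then obtain g S where gS: "F = (\<lambda>i. coatom_meet {i} #> g) ` S" "g \<in> carrier G" "S \<subseteq> {..<m}" "S \<noteq> {}" by blast
  have rc: "coatom_meet {i} #> g \<in> rcosets (coatom_meet {i})" for i
    by (rule rcosetsI[OF meet_subset_carrier gS(2)])
  have "C = coatom_meet {j} #> g" if C: "C \<in> F" "C \<in> rcosets (coatom_meet {j})" "j < m" for C j
  proof -
    obtain i where "i \<in> S" "C = coatom_meet {i} #> g" using C gS by blast
    then show ?thesis using rcosets_coatom_disjoint[OF rc[of i], of j] C gS(3) by auto
  qed
  then have "\<forall>B\<in>coatom_cosets. \<forall>C\<in>F \<inter> B. \<forall>D\<in>F \<inter> B. C = D"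
    unfolding coatom_cosets_def by auto
  moreover have "F \<subseteq> \<Union>coatom_cosets" using gS rc unfolding coatom_cosets_def by blast
  ultimately show "F \<in> transversals {} coatom_cosets"
    using gS(1,4) by (auto simp: transversals_def)
qed

lemma Inter_coatom_cosets:
  assumes "g \<in> carrier G" and "S \<subseteq> {..<m}" and "S \<noteq> {}"
  shows "\<Inter>((\<lambda>i. coatom_meet {i} #> g) ` S) = coatom_meet S #> g"
proof (rule Set.set_eqI)
  fix y
  obtain i where "i \<in> S" using assms(3) by blast
  moreover have "coatom_meet {i} #> g \<subseteq> carrier G" for i
    by (rule r_coset_subset_G[OF meet_subset_carrier assms(1)])
  ultimately show "y \<in> \<Inter>((\<lambda>i. coatom_meet {i} #> g) ` S) \<longleftrightarrow> y \<in> coatom_meet S #> g"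
    unfolding meet_rcos_iff[OF assms(2,1)] by blast
qed

text \<open>Nonemptiness of the transversal matches \<open>K \<noteq> carrier G\<close>.\<close>

lemma coset_poset_eq: "coset_poset G H = Inter ` transversals {} coatom_cosets"
proof (intro equalityI subsetI)
  fix C assume "C \<in> coset_poset G H"
  then obtain K g where K: "C = K #> g" "K \<in> subgroup_interval G H" "K \<noteq> carrier G" "g \<in> carrier G"
    by (auto simp: coset_poset_def)
  obtain S where S: "S \<subseteq> {..<m}" "K = coatom_meet S" using K(2) by (rule interval_cases)
  then have "S \<noteq> {}" using K(3) meet_empty by auto
  then have "C = \<Inter>((\<lambda>i. coatom_meet {i} #> g) ` S)" using Inter_coatom_cosets K S by simp
  then show "C \<in> Inter ` transversals {} coatom_cosets"
    unfolding transversals_coatom_cosets using K(4) S(1) \<open>S \<noteq> {}\<close> by blast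
next
  fix C assume "C \<in> Inter ` transversals {} coatom_cosets"
  then obtain g S where gS: "C = \<Inter>((\<lambda>i. coatom_meet {i} #> g) ` S)" "g \<in> carrier G" "S \<subseteq> {..<m}" "S \<noteq> {}"
    unfolding transversals_coatom_cosets by blast
  then have "C = coatom_meet S #> g" using Inter_coatom_cosets by simp
  moreover have "coatom_meet S \<noteq> carrier G" using meet_eq_iff[of S "{}"] gS meet_empty by simp
  ultimately show "C \<in> coset_poset G H"
    using gS(2) meet_in_interval unfolding coset_poset_def by blast
qed

text \<open>If the intersections are nested, an element \<open>g'\<close> of the smaller one
  represents both cosets; cancelling it gives nested subgroups, hence
  \<open>S \<subseteq> S'\<close>, and \<open>g'\<close> also represents every coset in
  \<open>F\<close>.\<close>

lemma Inter_transversals_subset_iff: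
  assumes "F \<in> transversals {} coatom_cosets" and "F' \<in> transversals {} coatom_cosets"
  shows "\<Inter>F' \<subseteq> \<Inter>F \<longleftrightarrow> F \<subseteq> F'"
proof
  assume sub: "\<Inter>F' \<subseteq> \<Inter>F"
  obtain g S where F: "F = (\<lambda>i. coatom_meet {i} #> g) ` S" "g \<in> carrier G" "S \<subseteq> {..<m}" "S \<noteq> {}"
    using assms(1) unfolding transversals_coatom_cosets by blast
  obtain g' S' where F': "F' = (\<lambda>i. coatom_meet {i} #> g') ` S'" "g' \<in> carrier G" "S' \<subseteq> {..<m}" "S' \<noteq> {}"
    using assms(2) unfolding transversals_coatom_cosets by blast
  have sub': "coatom_meet S' #> g' \<subseteq> coatom_meet S #> g"
    using sub Inter_coatom_cosets F F' by simp
  then have g': "g' \<in> coatom_meet S #> g" using rcos_self[OF F'(2) subgroup_meet] by blast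
  have "coatom_meet S #> g = coatom_meet S #> g'" using repr_independence[OF g' F(2) subgroup_meet] .
  have "coatom_meet S' \<subseteq> coatom_meet S"
  proof
    fix x assume x: "x \<in> coatom_meet S'"
    then have xG: "x \<in> carrier G" using meet_subset_carrier by blast
    have "x \<otimes> g' \<in> coatom_meet S #> g'"
      using sub' rcosI[OF x meet_subset_carrier F'(2)] \<open>coatom_meet S #> g = coatom_meet S #> g'\<close> by blast
    then show "x \<in> coatom_meet S"
      using mem_rcos_iff[OF subgroup_meet F'(2)] xG F'(2) by (simp add: m_assoc)
  qed
  then have "S \<subseteq> S'" using meet_subset_iff F(3) F'(3) by blast
  moreover have "coatom_meet {i} #> g = coatom_meet {i} #> g'" if "i \<in> S" for i
    using g' meet_rcos_iff[OF F(3,2)] that repr_independence[OF _ F(2) subgroup_meet] by blast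
  ultimately show "F \<subseteq> F'" using F(1) F'(1) by auto
qed blast

lemma betti_basis_coset_poset:
  "betti_basis (order_complex (coset_poset G H)) p
    (if p = int m - 1 then \<Prod>i<m. ind i - 1 else 0)"
proof (rule builds_betti_basis)
  let ?T = "transversals {} coatom_cosets"
  have "builds (int (card coatom_cosets) - 1) {} (\<Prod>B\<in>coatom_cosets. card B - 1) (order_complex ?T)"
  proof (rule builds_transversals)
    show "finite B \<and> B \<noteq> {}" if "B \<in> coatom_cosets" for B
      using that finite_rcosets coatom_in_rcosets by (auto simp: coatom_cosets_def)
  qed (auto simp: disjoint_coatom_cosets, simp add: coatom_cosets_def)
  moreover have "card coatom_cosets = m"
    unfolding coatom_cosets_def using card_image[OF inj_coatom_cosets] by simp
  moreover have "(\<Prod>B\<in>coatom_cosets. card B - 1) = (\<Prod>i<m. ind i - 1)"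
    unfolding coatom_cosets_def using inj_coatom_cosets by (simp add: prod.reindex ind_def)
  ultimately have "builds (int m - 1) {} (\<Prod>i<m. ind i - 1) (order_complex ?T)" by simp
  moreover have "inj_on Inter (\<Union>(order_complex ?T))"
  proof (rule inj_onI)
    fix F F' assume "F \<in> \<Union>(order_complex ?T)" "F' \<in> \<Union>(order_complex ?T)" and eq: "\<Inter>F = \<Inter>F'"
    then have "F \<in> ?T" "F' \<in> ?T" by (auto simp: order_complex_def)
    then show "F = F'"
      using Inter_transversals_subset_iff[of F F'] Inter_transversals_subset_iff[of F' F] eq by simp
  qed
  ultimately have "builds (int m - 1) (image Inter ` {}) (\<Prod>i<m. ind i - 1) (image Inter ` order_complex ?T)"
    by (rule builds_image)
  then show "builds (int m - 1) {} (\<Prod>i<m. ind i - 1) (order_complex (coset_poset G H))"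
    using order_complex_antitone_image[of ?T Inter] Inter_transversals_subset_iff
    by (simp add: coset_poset_eq)
qed (simp add: order_complex_def)

end

theorem theorem4p14:
  fixes G :: "('a, 'b) monoid_scheme" and H :: "'a set" and n :: int
  assumes "group G" and "finite (carrier G)" and "subgroup H G"
    and "n \<ge> -1"
    and "boolean_interval G H (nat (n + 1))"
    and "group_complemented G H"
  shows "(\<forall>i. i \<noteq> n \<longrightarrow> reduced_betti (order_complex (coset_poset G H)) i = 0)
    \<and> int (reduced_betti (order_complex (coset_poset G H)) n) = dual_totient G H
    \<and> dual_totient G H =
        int (card {H #>\<^bsub>G\<^esub> g | g. g \<in> carrier G \<and> generate G (H #>\<^bsub>G\<^esub> g) = carrier G})
    \<and> card {H #>\<^bsub>G\<^esub> g | g. g \<in> carrier G \<and> generate G (H #>\<^bsub>G\<^esub> g) = carrier G} \<noteq> 0"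
proof -
  obtain f where f: "bij_betw f (subgroup_interval G H) (Pow {..<nat (n + 1)})"
    "\<forall>K\<in>subgroup_interval G H. \<forall>L\<in>subgroup_interval G H. K \<subseteq> L \<longleftrightarrow> f K \<subseteq> f L"
    using assms(5) by (auto simp: boolean_interval_def)
  interpret group_complemented_boolean_interval G H "nat (n + 1)" f
    using assms f
    by (auto simp: group_complemented_boolean_interval_def group_complemented_boolean_interval_axioms_def)
  let ?k = "\<Prod>i<nat (n + 1). ind i - 1"
  \<comment> \<open>By \<open>n \<ge> -1\<close>, the top degree
    \<open>int (nat (n + 1)) - 1\<close> is \<open>n\<close>.\<close>
  have "betti_basis (order_complex (coset_poset G H)) p (if p = n then ?k else 0)" for p
    using betti_basis_coset_poset[of p] assms(4) by simp
  then have betti: "reduced_betti (order_complex (coset_poset G H)) p = (if p = n then ?k else 0)" for p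
    by (rule reduced_betti_eq)
  have "int ?k = (\<Prod>i<nat (n + 1). int (ind i) - 1)"
    unfolding of_nat_prod using ind_ge_2 by (intro prod.cong refl) fastforce
  moreover have "?k \<noteq> 0" using ind_ge_2 by fastforce
  ultimately show ?thesis using betti dual_totient_eq card_generating_cosets by simp
qed

end
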